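(* Let $S=[0,1]^2$. Let $\delta\in(0,1/14)$ and $\gamma\in(0,1-14\delta)$, let $1=h_1>h_2>h_3>\cdots>0$ be an admissible sequence, and let $\rho\colon S\to\mathbb{R}$ be the associated McMullen density, defined almost everywhere on $S$ (admissible sequences and the McMullen density are defined in the context). Then there exist no set $A\subset\mathbb{R}^2$ and no bilipschitz map $\varphi\colon S\to A$ (with image $A$) such that $\operatorname{Jac}(\varphi)=\rho$ almost everywhere in $S$.
   Context: Notation. $\lambda$ is Lebesgue measure on $\mathbb{R}^2$, and "almost everywhere" refers to it. A bijection $\varphi\colon A_1\to A_2$ between subsets of $\mathbb{R}^2$ is bilipschitz if there is $L>0$ such that both $\varphi$ and $\varphi^{-1}$ are $L$-Lipschitz for the Euclidean norm. $\operatorname{Jac}(\varphi)(x)=\det D\varphi(x)$ is the (signed) determinant of the Jacobian matrix of $\varphi$ at a point $x$ of differentiability; a bilipschitz map is differentiable almost everywhere. All squares are closed and axis-parallel, and values on the boundaries of squares (a null set) are irrelevant. Admissible sequence. Given $\delta,\gamma$, put $n_j:=h_{j-1}/h_j$ for $j\ge 2$. The sequence $(h_j)_{j\ge1}$ with $h_1=1$ is admissible if every $n_j$ is a positive integer divisible by $7$, $n_j\to\infty$ as $j\to\infty$, and each $n_j$ is large enough that $4(n_j-1)/n_j^2<\gamma$. Collections of squares. Let $\mathcal{S}_1=\{S\}$ with $S=[0,1]^2$. For every square $S'\in\mathcal{S}_j$ let $T'$ be the square concentric with $S'$ whose sidelength is $\delta$ times that of $S'$, and let $\mathcal{T}_j$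 be the collection of all these $T'$. For $j\ge2$, $\mathcal{S}_j$ is obtained as follows: for every $Q\in\mathcal{S}_{j-1}\cup\mathcal{T}_{j-1}$ with sidelength $\ell$, divide $Q$ into the $n_j\times n_j$ grid of squares of sidelength $\ell/n_j$ and put into $\mathcal{S}_j$ the $4(n_j-1)$ grid squares that have a side contained in an edge of $Q$ (so each edge of $Q$ is covered from inside by exactly $n_j$ squares). Functions $\rho_j$. Let $T$ be the square of side $\delta$ concentric with $S$. Choose constants $t_1>1$ and $0<s_1<1$ with $1-\gamma\le t_1\delta^2<1$ and $t_1\delta^2+s_1(1-\delta^2)=1$. Set $\rho_1=t_1$ on $T$ and $\rho_1=s_1$ on $S\setminus T$. For $j\ge2$, $\rho_j$ is obtained from $\rho_{j-1}$ by: (i) $\rho_j=\rho_{j-1}$ on $S\setminus\bigcup\mathcal{S}_{j-1}$; (ii) for every $S''\in\mathcal{S}_j$ with corresponding concentric square $T''\in\mathcal{T}_j$: $\rho_j=t_1$ on $T''$ and $\rho_j=s_1$ on $S''\setminus T''$; (iii) for every $S'\in\mathcal{S}_{j-1}$ with corresponding concentric square $T'\in\mathcal{T}_{j-1}$: $\rho_j=t_j$ on $T'\setminus\bigcup\mathcal{S}_j$ and $\rho_j=s_j$ on $(S'\setminus T')\setminus\bigcup\mathcal{S}_j$, where the constants $t_j,s_j$ are determined by $\int_{T'}\rho_j\,d\lambda=(1-\gamma)\lambda(S')$ and $\int_{S'}\rho_j\,d\lambda=\lambda(S')$. (By scaling, $t_j$ and $s_j$ do not depend on $S'$. Explicitly,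 with $\sigma_j=4(n_j-1)/n_j^2$, one has $t_j=\dfrac{1-\gamma-\delta^2\sigma_j}{\delta^2(1-\sigma_j)}$ and $s_j=\dfrac{\gamma-\sigma_j}{1-\delta^2-\sigma_j}$.) McMullen density. $\rho:=\lim_{j\to\infty}\rho_j$. This limit is well defined almost everywhere in $S$, bounded, and bounded away from $0$. For every $j$ and every $S'\in\mathcal{S}_j$ with concentric square $T'\in\mathcal{T}_j$ it satisfies $\int_{S'}\rho\,d\lambda=\lambda(S')$ and $\int_{T'}\rho\,d\lambda=(1-\gamma)\lambda(S')$. *)

theory Defs
  imports "HOL-Analysis.Analysis"
begin

text \<open>A closed axis-parallel square is represented by its lower left corner and its side length.\<close>

type_synonym square = "(real^2) \<times> real"

definition region :: "square \<Rightarrow> (real^2) set" where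
  "region Q = cbox (fst Q) (fst Q + vec (snd Q))"

abbreviation unit_square :: "(real^2) set" where
  "unit_square \<equiv> region (0, 1)"

definition concentric :: "real \<Rightarrow> square \<Rightarrow> square" where
  "concentric \<delta> Q = (fst Q + vec ((1 - \<delta>) / 2 * snd Q), \<delta> * snd Q)"

text \<open>The cells of the \<open>n \<times> n\<close> grid on \<open>Q\<close> that have a side contained in an edge of \<open>Q\<close>.\<close>

definition frame :: "nat \<Rightarrow> square \<Rightarrow> square set" where
  "frame n Q =
    {(fst Q + (snd Q / real n) *\<^sub>R vector [real i, real k], snd Q / real n) | i k.
       i < n \<and> k < n \<and> (i = 0 \<or> i = n - 1 \<or> k = 0 \<or> k = n - 1)}"

text \<open>Sequences are indexed from 1; all values at index 0 are irrelevant.\<close>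

definition ratio :: "(nat \<Rightarrow> real) \<Rightarrow> nat \<Rightarrow> real" where
  "ratio h j = h (j - 1) / h j"

definition admissible :: "real \<Rightarrow> (nat \<Rightarrow> real) \<Rightarrow> bool" where
  "admissible \<gamma> h \<longleftrightarrow>
     h 1 = 1 \<and>
     (\<forall>j\<ge>1. 0 < h (Suc j) \<and> h (Suc j) < h j) \<and>
     (\<forall>j\<ge>2. \<exists>m::nat. 0 < m \<and> 7 dvd m \<and> ratio h j = real m) \<and>
     filterlim (ratio h) at_top sequentially \<and>
     (\<forall>j\<ge>2. 4 * (ratio h j - 1) / (ratio h j)\<^sup>2 < \<gamma>)"

text \<open>For admissible \<open>h\<close> and \<open>j \<ge> 2\<close> the rounding in \<open>nat \<lfloor>ratio h j\<rfloor>\<close> is exact.\<close>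

fun squares :: "real \<Rightarrow> (nat \<Rightarrow> real) \<Rightarrow> nat \<Rightarrow> square set" where
  "squares \<delta> h 0 = {}"
| "squares \<delta> h (Suc 0) = {(0, 1)}"
| "squares \<delta> h (Suc (Suc j)) =
     (\<Union>Q \<in> squares \<delta> h (Suc j) \<union> concentric \<delta> ` squares \<delta> h (Suc j).
        frame (nat \<lfloor>ratio h (Suc (Suc j))\<rfloor>) Q)"

definition S_union :: "real \<Rightarrow> (nat \<Rightarrow> real) \<Rightarrow> nat \<Rightarrow> (real^2) set" where
  "S_union \<delta> h j = (\<Union>Q \<in> squares \<delta> h j. region Q)"

definition T_union :: "real \<Rightarrow> (nat \<Rightarrow> real) \<Rightarrow> nat \<Rightarrow> (real^2) set" where
  "T_union \<delta> h j = (\<Union>Q \<in> squares \<delta> h j. region (concentric \<delta> Q))"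

text \<open>
  For \<open>j \<ge> 2\<close>, \<open>\<sigma> = frame_area h j\<close> is the proportion of a square covered by its frame of \<open>4 * (n - 1)\<close> cells,
  and \<open>t_const\<close>, \<open>s_const\<close> are the unique constants for which the \<open>j\<close>-th approximant \<open>\<rho>\<close> below
  has integral \<open>(1 - \<gamma>) * \<lambda>(S')\<close> over \<open>T'\<close> and \<open>\<lambda>(S')\<close> over \<open>S'\<close>, for \<open>S'\<close> in
  \<open>squares \<delta> h (j - 1)\<close> and \<open>T' = concentric \<delta> S'\<close>.  On each cell \<open>\<rho>\<close> has average
  \<open>t1 * \<delta>\<^sup>2 + s1 * (1 - \<delta>\<^sup>2) = 1\<close>, so for \<open>\<lambda>(S') = 1\<close> these two conditions read
  \<open>\<delta>\<^sup>2 * \<sigma> + t * \<delta>\<^sup>2 * (1 - \<sigma>) = 1 - \<gamma>\<close> and \<open>\<sigma> + s * (1 - \<delta>\<^sup>2 - \<sigma>) = \<gamma>\<close>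
  (the latter on \<open>S' - T'\<close>).
\<close>

definition frame_area :: "(nat \<Rightarrow> real) \<Rightarrow> nat \<Rightarrow> real" where
  "frame_area h j = 4 * (ratio h j - 1) / (ratio h j)\<^sup>2"

definition t_const :: "real \<Rightarrow> real \<Rightarrow> (nat \<Rightarrow> real) \<Rightarrow> nat \<Rightarrow> real" where
  "t_const \<delta> \<gamma> h j = (1 - \<gamma> - \<delta>\<^sup>2 * frame_area h j) / (\<delta>\<^sup>2 * (1 - frame_area h j))"

definition s_const :: "real \<Rightarrow> real \<Rightarrow> (nat \<Rightarrow> real) \<Rightarrow> nat \<Rightarrow> real" where
  "s_const \<delta> \<gamma> h j = (\<gamma> - frame_area h j) / (1 - \<delta>\<^sup>2 - frame_area h j)"

definition initial_constants :: "real \<Rightarrow> real \<Rightarrow> real \<Rightarrow> real \<Rightarrow> bool" where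
  "initial_constants \<delta> \<gamma> t1 s1 \<longleftrightarrow>
     t1 > 1 \<and> 0 < s1 \<and> s1 < 1 \<and> 1 - \<gamma> \<le> t1 * \<delta>\<^sup>2 \<and> t1 * \<delta>\<^sup>2 < 1 \<and>
     t1 * \<delta>\<^sup>2 + s1 * (1 - \<delta>\<^sup>2) = 1"

text \<open>Only the values on \<open>unit_square\<close> matter.\<close>

fun approx_density ::
  "real \<Rightarrow> real \<Rightarrow> (nat \<Rightarrow> real) \<Rightarrow> real \<Rightarrow> real \<Rightarrow> nat \<Rightarrow> real^2 \<Rightarrow> real" where
  "approx_density \<delta> \<gamma> h t1 s1 0 x = 0"
| "approx_density \<delta> \<gamma> h t1 s1 (Suc 0) x = (if x \<in> T_union \<delta> h 1 then t1 else s1)"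
| "approx_density \<delta> \<gamma> h t1 s1 (Suc (Suc j)) x =
     (if x \<notin> S_union \<delta> h (Suc j) then approx_density \<delta> \<gamma> h t1 s1 (Suc j) x
      else if x \<in> S_union \<delta> h (Suc (Suc j))
        then (if x \<in> T_union \<delta> h (Suc (Suc j)) then t1 else s1)
      else if x \<in> T_union \<delta> h (Suc j) then t_const \<delta> \<gamma> h (Suc (Suc j))
      else s_const \<delta> \<gamma> h (Suc (Suc j)))"

definition mcmullen_density ::
  "real \<Rightarrow> real \<Rightarrow> (nat \<Rightarrow> real) \<Rightarrow> real \<Rightarrow> real \<Rightarrow> real^2 \<Rightarrow> real" where
  "mcmullen_density \<delta> \<gamma> h t1 s1 x = lim (\<lambda>j. approx_density \<delta> \<gamma> h t1 s1 j x)"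

definition bilipschitz ::
  "('a::metric_space \<Rightarrow> 'b::metric_space) \<Rightarrow> 'a set \<Rightarrow> 'b set \<Rightarrow> bool" where
  "bilipschitz \<phi> X Y \<longleftrightarrow>
     bij_betw \<phi> X Y \<and> (\<exists>L>0. L-lipschitz_on X \<phi> \<and> L-lipschitz_on Y (the_inv_into X \<phi>))"

text \<open>
  The Jacobian is a partial function, defined at the points of differentiability, and is therefore
  rendered as a relation: \<open>\<phi>\<close>, viewed as a map on \<open>X\<close>, is differentiable at \<open>x\<close> and the (signed)
  determinant of its derivative there is \<open>J\<close>.
\<close>

definition has_Jac :: "(real^2 \<Rightarrow> real^2) \<Rightarrow> (real^2) set \<Rightarrow> real^2 \<Rightarrow> real \<Rightarrow> bool" where
  "has_Jac \<phi> X x J \<longleftrightarrow> (\<exists>D. (\<phi> has_derivative D) (at x within X) \<and> det (matrix D) = J)"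

end

theory Submission
  imports Defs
begin

text \<open>
  The proof follows McMullen. Suppose that \<open>\<phi>\<close> is bilipschitz on the unit square with Jacobian \<open>\<rho>\<close>, and
  let \<open>M\<close> be the supremum of the stretch factors \<open>norm (\<phi> (p + l d) - \<phi> p) / l\<close> over the edges (from \<open>p\<close>
  to \<open>p + l d\<close>) of all squares of the construction. Since edges are subdivided again and again into
  edges of smaller squares, \<open>\<phi>\<close> is \<open>M\<close>-Lipschitz along every edge (\<open>edge_lipschitz\<close>).

  Some edge has stretch almost \<open>M\<close>, and by passing to one of its pieces it may be taken as deep in the
  construction as desired (\<open>nearly_maximal_edge\<close>). At the next stage it carries a row of \<open>n\<close> cells, where
  \<open>n\<close> is large. The bottom side of the row is stretched by almost the maximal amount, so that \<open>\<phi>\<close> is nearly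
  an affine map there, in a direction \<open>u\<close>. The top side of the row has its ends displaced by at
  most one cell's worth of stretch, which is negligible compared with the length of the row. Averaging over
  blocks of seven consecutive cells yields a block whose bottom and top sides are both mapped nearly onto
  parallel segments of length \<open>7 M c\<close>, where \<open>c\<close> is the side of a cell (\<open>two_straight_lines\<close>).

  The image of the block has area about \<open>7 c\<^sup>2\<close>. Its frontier consists of these two near-segments
  and of two pieces that stay near the four corners, so its middle part is a strip of height of order
  \<open>c / M\<close>. The central square \<open>T'\<close> of the middle cell has image of area about \<open>(1 - \<gamma>) c\<^sup>2\<close> inside this
  strip, but of width only of order \<open>\<delta> M c\<close> in the direction \<open>u\<close>, because the edges of \<open>T'\<close>
  are stretched by at most \<open>M\<close> as well. Its area is therefore less than \<open>14 \<delta> c\<^sup>2\<close>, which contradicts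
  \<open>\<gamma> < 1 - 14 \<delta>\<close> (\<open>no_long_thin_image\<close>).

  The areas are only needed approximately and at deep stages: off the next frames, which have
  negligible area and hence a negligible image, \<open>\<rho>\<close> is constant on each of \<open>T'\<close> and \<open>S' - T'\<close>,
  and the change of variables formula applies (\<open>square_areas\<close>, \<open>eventually_square_areas\<close>).
\<close>

section \<open>Rectangles in orthonormal frames\<close>

definition orthonormal :: "real^2 \<Rightarrow> real^2 \<Rightarrow> bool" where
  "orthonormal d b \<longleftrightarrow> norm d = 1 \<and> norm b = 1 \<and> d \<bullet> b = 0"

lemma inner_2: "(x::real^2) \<bullet> y = x$1 * y$1 + x$2 * y$2"
  by (simp add: inner_vec_def sum_2)

lemma orthonormal_expand:
  assumes "orthonormal d b"
  shows "z = (z \<bullet> d) *\<^sub>R d + (z \<bullet> b) *\<^sub>R b"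
proof -
  have n: "d \<bullet> d = 1" "b \<bullet> b = 1" "d \<bullet> b = 0"
    using assms by (auto simp: orthonormal_def norm_eq_1)
  then have n': "d$1 * d$1 + d$2 * d$2 = 1" "b$1 * b$1 + b$2 * b$2 = 1" "d$1 * b$1 + d$2 * b$2 = 0"
    by (simp_all add: inner_2)
  have "z$1 = (z$1 * d$1 + z$2 * d$2) * d$1 + (z$1 * b$1 + z$2 * b$2) * b$1"
    using n' by algebra
  moreover have "z$2 = (z$1 * d$1 + z$2 * d$2) * d$2 + (z$1 * b$1 + z$2 * b$2) * b$2"
    using n' by algebra
  ultimately show ?thesis
    by (simp add: vec_eq_iff forall_2 inner_2)
qed

lemma orthonormal_inner:
  assumes "orthonormal d b"
  shows "(s *\<^sub>R d + t *\<^sub>R b) \<bullet> d = s" "(s *\<^sub>R d + t *\<^sub>R b) \<bullet> b = t"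
    "d \<bullet> d = 1" "b \<bullet> b = 1" "d \<bullet> b = 0" "b \<bullet> d = 0"
  using assms by (auto simp: orthonormal_def norm_eq_1 inner_simps inner_commute)

definition rect :: "real^2 \<Rightarrow> real^2 \<Rightarrow> real^2 \<Rightarrow> real \<Rightarrow> real \<Rightarrow> (real^2) set" where
  "rect p d b \<alpha> \<beta> = {z. 0 \<le> (z - p) \<bullet> d \<and> (z - p) \<bullet> d \<le> \<alpha> \<and> 0 \<le> (z - p) \<bullet> b \<and> (z - p) \<bullet> b \<le> \<beta>}"

definition open_rect :: "real^2 \<Rightarrow> real^2 \<Rightarrow> real^2 \<Rightarrow> real \<Rightarrow> real \<Rightarrow> (real^2) set" where
  "open_rect p d b \<alpha> \<beta> = {z. 0 < (z - p) \<bullet> d \<and> (z - p) \<bullet> d < \<alpha> \<and> 0 < (z - p) \<bullet> b \<and> (z - p) \<bullet> b < \<beta>}"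

lemma orthonormal_rect_cases:
  assumes "orthonormal d b" "z \<in> rect p d b \<alpha> \<beta>"
  obtains s t where "z = p + s *\<^sub>R d + t *\<^sub>R b" "0 \<le> s" "s \<le> \<alpha>" "0 \<le> t" "t \<le> \<beta>"
proof
  show "z = p + ((z - p) \<bullet> d) *\<^sub>R d + ((z - p) \<bullet> b) *\<^sub>R b"
    using orthonormal_expand[OF assms(1), of "z - p"] by (simp add: algebra_simps)
qed (use assms(2) in \<open>auto simp: rect_def\<close>)

lemma rect_mem:
  assumes "orthonormal d b"
  shows "p + s *\<^sub>R d + t *\<^sub>R b \<in> rect p d b \<alpha> \<beta> \<longleftrightarrow> 0 \<le> s \<and> s \<le> \<alpha> \<and> 0 \<le> t \<and> t \<le> \<beta>"
  using orthonormal_inner[OF assms] by (simp add: rect_def add.assoc)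

lemma open_rect_mem:
  assumes "orthonormal d b"
  shows "p + s *\<^sub>R d + t *\<^sub>R b \<in> open_rect p d b \<alpha> \<beta> \<longleftrightarrow> 0 < s \<and> s < \<alpha> \<and> 0 < t \<and> t < \<beta>"
  using orthonormal_inner[OF assms] by (simp add: open_rect_def add.assoc)

lemma rect_eq_image:
  assumes "orthonormal d b"
  shows "rect p d b \<alpha> \<beta> =
    (\<lambda>x. p + (x$1 *\<^sub>R d + x$2 *\<^sub>R b)) ` cbox 0 (vector [\<alpha>, \<beta>] :: real^2)"
proof (intro equalityI subsetI)
  fix z assume "z \<in> rect p d b \<alpha> \<beta>"
  then obtain s t where "z = p + s *\<^sub>R d + t *\<^sub>R b" "0 \<le> s" "s \<le> \<alpha>" "0 \<le> t" "t \<le> \<beta>"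
    using orthonormal_rect_cases[OF assms] by blast
  then show "z \<in> (\<lambda>x. p + (x$1 *\<^sub>R d + x$2 *\<^sub>R b)) ` cbox 0 (vector [\<alpha>, \<beta>] :: real^2)"
    by (intro image_eqI[of _ _ "vector [s, t]"]) (auto simp: mem_box_cart forall_2 add.assoc)
next
  fix z assume "z \<in> (\<lambda>x. p + (x$1 *\<^sub>R d + x$2 *\<^sub>R b)) ` cbox 0 (vector [\<alpha>, \<beta>] :: real^2)"
  then show "z \<in> rect p d b \<alpha> \<beta>"
    using rect_mem[OF assms] by (auto simp: mem_box_cart forall_2 add.assoc[symmetric])
qed

lemma compact_rect:
  assumes "orthonormal d b"
  shows "compact (rect p d b \<alpha> \<beta>)"
  unfolding rect_eq_image[OF assms]
  by (intro compact_continuous_image continuous_intros compact_cbox)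

lemma convex_rect: "convex (rect p d b \<alpha> \<beta>)"
proof -
  have "rect p d b \<alpha> \<beta> = {z. d \<bullet> z \<ge> d \<bullet> p} \<inter> {z. d \<bullet> z \<le> \<alpha> + d \<bullet> p} \<inter> {z. b \<bullet> z \<ge> b \<bullet> p} \<inter> {z. b \<bullet> z \<le> \<beta> + b \<bullet> p}"
    by (auto simp: rect_def inner_diff_left inner_commute[of d] inner_commute[of b])
  then show ?thesis
    by (auto intro!: convex_Int convex_halfspace_le convex_halfspace_ge)
qed

lemma open_open_rect: "open (open_rect p d b \<alpha> \<beta>)"
  unfolding open_rect_def
  by (intro open_Collect_conj open_Collect_less continuous_intros)

lemma open_rect_subset: "open_rect p d b \<alpha> \<beta> \<subseteq> rect p d b \<alpha> \<beta>"
  by (auto simp: open_rect_def rect_def)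

lemma measure_rect:
  assumes "orthonormal d b" "0 \<le> \<alpha>" "0 \<le> \<beta>"
  shows "measure lebesgue (rect p d b \<alpha> \<beta>) = \<alpha> * \<beta>"
proof -
  let ?F = "\<lambda>x::real^2. x$1 *\<^sub>R d + x$2 *\<^sub>R b"
  have lin: "linear ?F"
    by (intro linearI) (auto simp: algebra_simps)
  have "?F v \<bullet> ?F w = v \<bullet> w" for v w
    using orthonormal_inner(3-6)[OF assms(1)] by (simp add: inner_simps inner_2[of v w])
  then have orth: "orthogonal_transformation ?F"
    using lin by (simp add: orthogonal_transformation_def)
  have "rect p d b \<alpha> \<beta> = (+) p ` ?F ` cbox 0 (vector [\<alpha>, \<beta>])"
    unfolding rect_eq_image[OF assms(1)] by (simp add: image_image)
  then have "measure lebesgue (rect p d b \<alpha> \<beta>) = measure lebesgue (?F ` cbox 0 (vector [\<alpha>, \<beta>]))"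
    by (simp add: measure_translation)
  also have "\<dots> = measure lebesgue (cbox 0 (vector [\<alpha>, \<beta>] :: real^2))"
    by (rule measure_orthogonal_image[OF orth]) auto
  also have "\<dots> = \<alpha> * \<beta>"
    using assms(2,3) content_cbox_cart[of 0 "vector [\<alpha>, \<beta>] :: real^2"]
    by (simp add: UNIV_2 interval_ne_empty_cart forall_2)
  finally show ?thesis .
qed

text \<open>
  A ray leaves every bounded set, and by connectedness it does so through the frontier. This stands in for the
  Jordan curve theorem: a point of an image is located by the frontier points above and below it.
\<close>

lemma ray_meets_frontier:
  fixes z v :: "'a::euclidean_space"
  assumes "bounded K" "z \<in> K" "v \<noteq> 0"
  obtains t where "t \<ge> 0" "z + t *\<^sub>R v \<in> frontier K"
proof -
  obtain B where B: "\<And>x. x \<in> K \<Longrightarrow> norm x \<le> B"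
    using assms(1) bounded_iff by blast
  let ?R = "(\<lambda>t. z + t *\<^sub>R v) ` {0..}"
  let ?t = "(norm z + \<bar>B\<bar> + 1) / norm v"
  have "norm (?t *\<^sub>R v) = norm z + \<bar>B\<bar> + 1"
    using assms(3) by simp
  then have "norm (z + ?t *\<^sub>R v) > B"
    using norm_triangle_ineq2[of "?t *\<^sub>R v" "- z"] by (simp add: add.commute)
  then have "z + ?t *\<^sub>R v \<in> ?R - K"
    using B by force
  moreover have "z \<in> ?R \<inter> K"
    using assms(2) by (auto intro: image_eqI[of _ _ 0])
  moreover have "connected ?R"
    by (intro connected_continuous_image continuous_intros) auto
  ultimately have "?R \<inter> frontier K \<noteq> {}"
    using connected_Int_frontier[of ?R K] by blast
  then show thesis
    using that by auto
qed

text \<open>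
  By invariance of domain the image of the open rectangle is open.
\<close>

lemma frontier_image_rect:
  fixes f :: "real^2 \<Rightarrow> real^2"
  assumes "orthonormal d b" "continuous_on (rect p d b \<alpha> \<beta>) f" "inj_on f (rect p d b \<alpha> \<beta>)"
  shows "frontier (f ` rect p d b \<alpha> \<beta>) \<subseteq> f ` (rect p d b \<alpha> \<beta> - open_rect p d b \<alpha> \<beta>)"
proof -
  let ?R = "rect p d b \<alpha> \<beta>" and ?U = "open_rect p d b \<alpha> \<beta>"
  have "open (f ` ?U)"
    by (intro invariance_of_domain open_open_rect continuous_on_subset[OF assms(2)]
        inj_on_subset[OF assms(3)] open_rect_subset)
  then have "f ` ?U \<subseteq> interior (f ` ?R)"
    by (intro interior_maximal image_mono open_rect_subset)
  moreover have "closed (f ` ?R)"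
    by (intro compact_imp_closed compact_continuous_image assms compact_rect)
  ultimately show ?thesis
    by (auto simp: frontier_def)
qed

text \<open>
  A bound on a linear functional over the image of the sides of a rectangle extends to the whole image: the
  ray in the direction \<open>u\<close> from an image point meets the frontier, where the functional is even larger.
\<close>

lemma image_rect_halfspace:
  fixes f :: "real^2 \<Rightarrow> real^2"
  assumes "orthonormal d b" "continuous_on (rect p d b \<alpha> \<beta>) f" "inj_on f (rect p d b \<alpha> \<beta>)"
    and "u \<noteq> 0"
    and bd: "\<And>q. q \<in> rect p d b \<alpha> \<beta> - open_rect p d b \<alpha> \<beta> \<Longrightarrow> f q \<bullet> u \<le> B"
    and "q \<in> rect p d b \<alpha> \<beta>"
  shows "f q \<bullet> u \<le> B"
proof -
  have "bounded (f ` rect p d b \<alpha> \<beta>)"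
    by (intro compact_imp_bounded compact_continuous_image assms compact_rect)
  then obtain t where t: "t \<ge> 0" "f q + t *\<^sub>R u \<in> frontier (f ` rect p d b \<alpha> \<beta>)"
    using ray_meets_frontier assms by blast
  have "(f q + t *\<^sub>R u) \<bullet> u \<le> B"
    using t(2) bd frontier_image_rect[OF assms(1-3)] by fastforce
  moreover have "t * (u \<bullet> u) \<ge> 0"
    using t(1) by simp
  ultimately show ?thesis
    by (simp add: inner_simps)
qed

section \<open>A long thin image cannot hold a tall piece\<close>

text \<open>
  If a path with speed at most \<open>M\<close> travels almost as far as it can in the direction \<open>u\<close> (with loss at most
  \<open>\<kappa>\<close>), then each of its points has also lost at most \<open>\<kappa>\<close>, and by Pythagoras its deviation in the
  perpendicular direction is of order \<open>sqrt (M S \<kappa>)\<close>.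
\<close>

lemma nearly_straight:
  fixes a z c :: "real^2"
  assumes "orthonormal u w" "0 \<le> s" "s \<le> S" "0 \<le> M" "0 \<le> \<kappa>"
    and az: "norm (z - a) \<le> M * s" and zc: "norm (c - z) \<le> M * (S - s)"
    and ca: "(c - a) \<bullet> u \<ge> M * S - \<kappa>"
    and e: "2 * M * S * \<kappa> < e\<^sup>2" "0 < e"
  shows "(z - a) \<bullet> u \<ge> M * s - \<kappa>" "\<bar>(z - a) \<bullet> w\<bar> < e"
proof -
  have "(c - z) \<bullet> u \<le> M * (S - s)"
    using zc norm_cauchy_schwarz[of "c - z" u] assms(1) by (simp add: orthonormal_def)
  then show u: "(z - a) \<bullet> u \<ge> M * s - \<kappa>"
    using ca by (simp add: algebra_simps inner_diff_left)
  let ?v = "z - a"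
  have "?v \<bullet> ?v = (?v \<bullet> u)\<^sup>2 + (?v \<bullet> w)\<^sup>2"
    using arg_cong[OF orthonormal_expand[OF assms(1), of ?v], of "\<lambda>x. ?v \<bullet> x"]
    by (simp add: inner_right_distrib power2_eq_square)
  moreover have "?v \<bullet> ?v \<le> (M * s)\<^sup>2"
    using az by (metis dot_square_norm norm_ge_zero power_mono)
  ultimately have w: "(?v \<bullet> w)\<^sup>2 \<le> (M * s)\<^sup>2 - (?v \<bullet> u)\<^sup>2"
    by simp
  have Ms: "0 \<le> M * s" "M * s \<le> M * S"
    using assms(2-4) by (auto intro: mult_left_mono)
  have "(?v \<bullet> w)\<^sup>2 \<le> 2 * (M * s) * \<kappa>"
  proof (cases "\<kappa> \<le> M * s")
    case True
    then have "(M * s - \<kappa>)\<^sup>2 \<le> (?v \<bullet> u)\<^sup>2"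
      using u by (intro power_mono) auto
    with w have "(?v \<bullet> w)\<^sup>2 \<le> (M * s)\<^sup>2 - (M * s - \<kappa>)\<^sup>2"
      by simp
    also have "\<dots> = 2 * (M * s) * \<kappa> - \<kappa>\<^sup>2"
      by (simp add: power2_eq_square algebra_simps)
    finally show ?thesis
      using zero_le_power2[of \<kappa>] by linarith
  next
    case False
    have "(?v \<bullet> w)\<^sup>2 \<le> (M * s) * (M * s)"
      using w zero_le_power2[of "?v \<bullet> u"] power2_eq_square[of "M * s"] by linarith
    also have "\<dots> \<le> (M * s) * (2 * \<kappa>)"
      using False Ms assms(5) by (intro mult_left_mono) auto
    finally show ?thesis
      by (simp add: algebra_simps)
  qed
  also have "\<dots> \<le> 2 * (M * S) * \<kappa>"
    using Ms assms(5) by (intro mult_right_mono) auto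
  also have "\<dots> < e\<^sup>2"
    using e by (simp add: mult.assoc)
  finally show "\<bar>(z - a) \<bullet> w\<bar> < e"
    using e(2) by (metis abs_of_pos power2_abs power_less_imp_less_base abs_ge_zero less_eq_real_def)
qed

text \<open>
  The geometric core. The map \<open>f\<close> is given on a row of seven squares of side \<open>l\<close>, with corner \<open>p\<close> and axes
  \<open>d\<close>, \<open>b\<close>. Along the two long sides of the row (starting at \<open>p\<close> and \<open>p + l b\<close>) it has speed at most \<open>M\<close> and
  nearly achieves it, with loss \<open>\<kappa>\<close>; \<open>e\<close> bounds the resulting deviation from straight lines. The square with
  corner \<open>r\<close> lies in the middle (fourth) square of the row. Then the row's area bounds the
  height of its image by \<open>2 e + 2 l / M\<close>, and the image of the small square, being at most
  \<open>4 \<delta> M l\<close> wide, is too small to have area \<open>14 \<delta> l\<^sup>2\<close>.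
\<close>

lemma no_long_thin_image:
  fixes f :: "real^2 \<Rightarrow> real^2" and \<delta> l M \<kappa> e :: real
  assumes db: "orthonormal d b" and uw: "orthonormal u w"
    and pos: "0 < l" "0 < M" "0 < \<delta>" "0 \<le> \<kappa>" "0 < e"
    and small: "2 * \<kappa> < M * l" "14 * M * l * \<kappa> < e\<^sup>2" "8 * M * e < 3 * l"
    and cont: "continuous_on (rect p d b (7 * l) l) f" and inj: "inj_on f (rect p d b (7 * l) l)"
    and row1: "\<And>a s. a \<in> {p, p + l *\<^sub>R b} \<Longrightarrow> 0 \<le> s \<Longrightarrow> s \<le> 7 * l \<Longrightarrow> norm (f (a + s *\<^sub>R d) - f a) \<le> M * s"
    and row2: "\<And>a s. a \<in> {p, p + l *\<^sub>R b} \<Longrightarrow> 0 \<le> s \<Longrightarrow> s \<le> 7 * l \<Longrightarrow>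
      norm (f (a + (7 * l) *\<^sub>R d) - f (a + s *\<^sub>R d)) \<le> M * (7 * l - s)"
    and tight: "\<And>a. a \<in> {p, p + l *\<^sub>R b} \<Longrightarrow> (f (a + (7 * l) *\<^sub>R d) - f a) \<bullet> u \<ge> M * (7 * l) - \<kappa>"
    and ends: "\<And>a t. a \<in> {p, p + (7 * l) *\<^sub>R d} \<Longrightarrow> 0 \<le> t \<Longrightarrow> t \<le> l \<Longrightarrow> norm (f (a + t *\<^sub>R b) - f a) \<le> M * t"
    and mid: "\<And>a q. a \<in> {p + (3 * l) *\<^sub>R d, p + (4 * l) *\<^sub>R d} \<Longrightarrow>
      q \<in> rect (p + (3 * l) *\<^sub>R d) d b l l - open_rect (p + (3 * l) *\<^sub>R d) d b l l \<Longrightarrow> norm (f q - f a) \<le> 2 * M * l"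
    and small_sub: "rect r d b (\<delta> * l) (\<delta> * l) \<subseteq> rect (p + (3 * l) *\<^sub>R d) d b l l"
    and small_bd: "\<And>q. q \<in> rect r d b (\<delta> * l) (\<delta> * l) - open_rect r d b (\<delta> * l) (\<delta> * l) \<Longrightarrow>
      norm (f q - f r) \<le> 2 * M * (\<delta> * l)"
    and area_row: "measure lebesgue (f ` rect p d b (7 * l) l) \<le> 8 * l\<^sup>2"
    and area_small: "measure lebesgue (f ` rect r d b (\<delta> * l) (\<delta> * l)) \<ge> 14 * \<delta> * l\<^sup>2"
  shows False
proof -
  let ?R = "rect p d b (7 * l) l" and ?S = "rect (p + (3 * l) *\<^sub>R d) d b l l"
    and ?T = "rect r d b (\<delta> * l) (\<delta> * l)"
  define x0 y0 y1 where "x0 = f p \<bullet> u" and "y0 = f p \<bullet> w" and "y1 = f (p + l *\<^sub>R b) \<bullet> w"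
  define lo hi where "lo = min y0 y1" and "hi = max y0 y1"
  have u1: "norm u = 1" "u \<noteq> 0" "w \<noteq> 0" "norm w = 1"
    using uw by (auto simp: orthonormal_def)
  have cs: "\<bar>v \<bullet> u\<bar> \<le> norm v" for v
    using Cauchy_Schwarz_ineq2[of v u] u1 by simp
  have SR: "?S \<subseteq> ?R"
  proof
    fix z assume "z \<in> ?S"
    then obtain s t where z: "z = p + (3 * l) *\<^sub>R d + s *\<^sub>R d + t *\<^sub>R b" "0 \<le> s" "s \<le> l" "0 \<le> t" "t \<le> l"
      using orthonormal_rect_cases[OF db] by blast
    then have "z = p + (3 * l + s) *\<^sub>R d + t *\<^sub>R b"
      by (simp add: algebra_simps)
    also have "\<dots> \<in> ?R"
      using rect_mem[OF db] z(2-) pos(1) by simp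
    finally show "z \<in> ?R" .
  qed
  have contS: "continuous_on ?S f" "inj_on f ?S" and contT: "continuous_on ?T f" "inj_on f ?T"
    using cont inj SR small_sub by (meson continuous_on_subset inj_on_subset subset_trans)+
  have comp: "compact (f ` ?R)" "compact (f ` ?T)"
    by (intro compact_continuous_image compact_rect db cont contT)+
  have \<kappa>14: "2 * M * (7 * l) * \<kappa> < e\<^sup>2"
    using small(2) by simp
  \<comment> \<open>Away from the ends, the frontier of the image of the row lies in two horizontal bands of half-width \<open>e\<close>: the short sides stay near the ends, and \<open>u\<close>-coordinates between \<open>3/2 M l\<close> and \<open>11/2 M l\<close> (counted from the image of \<open>p\<close>) are out of their reach.\<close>
  have band: "\<bar>z \<bullet> w - y0\<bar> < e \<or> \<bar>z \<bullet> w - y1\<bar> < e"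
    if z: "z \<in> frontier (f ` ?R)" "x0 + 3/2 * M * l \<le> z \<bullet> u" "z \<bullet> u \<le> x0 + 11/2 * M * l" for z
  proof -
    obtain q where q: "q \<in> ?R - open_rect p d b (7 * l) l" "z = f q"
      using z(1) frontier_image_rect[OF db cont inj] by auto
    then obtain s t where st: "q = p + s *\<^sub>R d + t *\<^sub>R b" "0 \<le> s" "s \<le> 7 * l" "0 \<le> t" "t \<le> l"
      using orthonormal_rect_cases[OF db] by blast
    have "\<not> (0 < s \<and> s < 7 * l \<and> 0 < t \<and> t < l)"
      using q(1) st(1) open_rect_mem[OF db] by simp
    then consider "s = 0" | "s = 7 * l" | "t = 0" | "t = l"
      using st by force
    then show ?thesis
    proof cases
      case 1
      have "norm (z - f p) \<le> M * l"
        using ends[of p t] 1 st q(2) pos by (intro order.trans[OF _ mult_left_mono[of t l M]]) auto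
      then have "z \<bullet> u - x0 \<le> M * l"
        using cs[of "z - f p"] by (simp add: x0_def inner_diff_left)
      then show ?thesis
        using z(2) mult_pos_pos[OF pos(2,1)] by simp
    next
      case 2
      have "norm (z - f (p + (7 * l) *\<^sub>R d)) \<le> M * l"
        using ends[of "p + (7 * l) *\<^sub>R d" t] 2 st q(2) pos
        by (intro order.trans[OF _ mult_left_mono[of t l M]]) auto
      then have "z \<bullet> u \<ge> f (p + (7 * l) *\<^sub>R d) \<bullet> u - M * l"
        using cs[of "z - f (p + (7 * l) *\<^sub>R d)"] by (simp add: inner_diff_left)
      moreover have "f (p + (7 * l) *\<^sub>R d) \<bullet> u - x0 \<ge> M * (7 * l) - \<kappa>"
        using tight[of p] by (simp add: x0_def inner_diff_left)
      ultimately show ?thesis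
        using z(3) small(1) by (simp add: algebra_simps)
    next
      case 3
      have "\<bar>(z - f p) \<bullet> w\<bar> < e"
        by (rule nearly_straight(2)[OF uw st(2,3) _ pos(4), of M _ _ "f (p + (7 * l) *\<^sub>R d)"])
          (use 3 st q(2) pos row1[of p s] row2[of p s] tight[of p] \<kappa>14 in auto)
      then show ?thesis
        by (simp add: y0_def inner_diff_left)
    next
      case 4
      have eq: "z = f (p + l *\<^sub>R b + s *\<^sub>R d)"
        using 4 st(1) q(2) by (simp add: algebra_simps)
      have "\<bar>(z - f (p + l *\<^sub>R b)) \<bullet> w\<bar> < e"
        by (rule nearly_straight(2)[OF uw st(2,3) _ pos(4), of M _ _ "f (p + l *\<^sub>R b + (7 * l) *\<^sub>R d)"])
          (use eq st(2-) pos row1[of "p + l *\<^sub>R b" s] row2[of "p + l *\<^sub>R b" s] tight[of "p + l *\<^sub>R b"] \<kappa>14 in auto)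
      then show ?thesis
        by (simp add: y1_def inner_diff_left)
    qed
  qed
  \<comment> \<open>A point of the image above both bands could escape vertically without meeting the frontier, and likewise below.\<close>
  have height: "lo - e \<le> z \<bullet> w" "z \<bullet> w \<le> hi + e"
    if z: "z \<in> f ` ?R" "x0 + 3/2 * M * l \<le> z \<bullet> u" "z \<bullet> u \<le> x0 + 11/2 * M * l" for z
  proof -
    have wu: "w \<bullet> u = 0" "w \<bullet> w = 1"
      using orthonormal_inner[OF uw] by auto
    obtain t where t: "t \<ge> 0" "z + t *\<^sub>R w \<in> frontier (f ` ?R)"
      using ray_meets_frontier[OF compact_imp_bounded[OF comp(1)] z(1) u1(3)] .
    have "(z + t *\<^sub>R w) \<bullet> w \<le> hi + e"
      using band[OF t(2)] z wu by (auto simp: inner_simps hi_def)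
    then show "z \<bullet> w \<le> hi + e"
      using t(1) wu by (simp add: inner_simps)
    obtain t where t: "t \<ge> 0" "z + t *\<^sub>R (- w) \<in> frontier (f ` ?R)"
      using ray_meets_frontier[OF compact_imp_bounded[OF comp(1)] z(1), of "- w"] u1(3) by auto
    have "(z + t *\<^sub>R (- w)) \<bullet> w \<ge> lo - e"
      using band[OF t(2)] z wu by (auto simp: inner_simps lo_def)
    then show "lo - e \<le> z \<bullet> w"
      using t(1) wu by (simp add: inner_simps)
  qed
  \<comment> \<open>The image of the middle square lies over the central range of \<open>u\<close>-coordinates: its sides are within \<open>2 M l\<close> of both of its bottom corners.\<close>
  have place: "x0 + 3/2 * M * l \<le> f q \<bullet> u \<and> f q \<bullet> u \<le> x0 + 11/2 * M * l" if q: "q \<in> ?S" for q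
  proof
    have "norm (f (p + (3 * l) *\<^sub>R d) - f p) \<le> M * (3 * l)"
      using row1[of p "3 * l"] pos by simp
    then have A: "f (p + (3 * l) *\<^sub>R d) \<bullet> u \<le> x0 + 3 * M * l"
      using cs[of "f (p + (3 * l) *\<^sub>R d) - f p"] by (simp add: inner_diff_left x0_def)
    have "(f (p + (4 * l) *\<^sub>R d) - f p) \<bullet> u \<ge> M * (4 * l) - \<kappa>"
      by (rule nearly_straight(1)[OF uw _ _ _ pos(4), where S = "7 * l" and c = "f (p + (7 * l) *\<^sub>R d)" and e = e])
        (use pos row1[of p "4 * l"] row2[of p "4 * l"] tight[of p] \<kappa>14 in auto)
    then have B: "f (p + (4 * l) *\<^sub>R d) \<bullet> u \<ge> x0 + 4 * M * l - \<kappa>"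
      by (simp add: inner_diff_left x0_def)
    show "f q \<bullet> u \<le> x0 + 11/2 * M * l"
    proof (rule image_rect_halfspace[OF db contS u1(2) _ q])
      fix q assume "q \<in> ?S - open_rect (p + (3 * l) *\<^sub>R d) d b l l"
      then have "norm (f q - f (p + (3 * l) *\<^sub>R d)) \<le> 2 * M * l"
        using mid by blast
      then show "f q \<bullet> u \<le> x0 + 11/2 * M * l"
        using cs[of "f q - f (p + (3 * l) *\<^sub>R d)"] A mult_pos_pos[OF pos(2,1)]
        by (simp add: inner_diff_left)
    qed
    have "f q \<bullet> (- u) \<le> - (x0 + 3/2 * M * l)"
    proof (rule image_rect_halfspace[OF db contS _ _ q])
      fix q assume "q \<in> ?S - open_rect (p + (3 * l) *\<^sub>R d) d b l l"
      then have "norm (f q - f (p + (4 * l) *\<^sub>R d)) \<le> 2 * M * l"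
        using mid by blast
      then show "f q \<bullet> (- u) \<le> - (x0 + 3/2 * M * l)"
        using cs[of "f q - f (p + (4 * l) *\<^sub>R d)"] B small(1)
        by (simp add: inner_diff_left)
    qed (use u1 in auto)
    then show "x0 + 3/2 * M * l \<le> f q \<bullet> u"
      by simp
  qed
  define c W where "c = f r \<bullet> u - 2 * M * (\<delta> * l)" and "W = 4 * M * (\<delta> * l)"
  have W0: "0 \<le> W"
    using pos by (simp add: W_def)
  have width: "c \<le> f q \<bullet> u \<and> f q \<bullet> u \<le> c + W" if q: "q \<in> ?T" for q
  proof
    show "f q \<bullet> u \<le> c + W"
    proof (rule image_rect_halfspace[OF db contT u1(2) _ q])
      fix q assume "q \<in> ?T - open_rect r d b (\<delta> * l) (\<delta> * l)"
      then show "f q \<bullet> u \<le> c + W"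
        using cs[of "f q - f r"] small_bd[of q] by (simp add: inner_diff_left c_def W_def)
    qed
    have "f q \<bullet> (- u) \<le> - c"
    proof (rule image_rect_halfspace[OF db contT _ _ q])
      fix q assume "q \<in> ?T - open_rect r d b (\<delta> * l) (\<delta> * l)"
      then show "f q \<bullet> (- u) \<le> - c"
        using cs[of "f q - f r"] small_bd[of q] by (simp add: inner_diff_left c_def)
    qed (use u1 in auto)
    then show "c \<le> f q \<bullet> u"
      by simp
  qed
  have TR: "f ` ?T \<subseteq> f ` ?R"
    using small_sub SR by blast
  have heightT: "lo - e \<le> f q \<bullet> w" "f q \<bullet> w \<le> hi + e" if "q \<in> ?T" for q
    using height[of "f q"] place[of q] that small_sub SR by auto
  let ?o = "\<lambda>x y. x *\<^sub>R u + y *\<^sub>R w"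
  have o_rect: "z \<in> rect (?o x y) u w \<alpha> \<beta> \<longleftrightarrow> x \<le> z \<bullet> u \<and> z \<bullet> u \<le> x + \<alpha> \<and> y \<le> z \<bullet> w \<and> z \<bullet> w \<le> y + \<beta>"
    for z x y \<alpha> \<beta>
    using orthonormal_inner[OF uw] by (auto simp: rect_def inner_diff_left)
  have hilo: "lo \<le> hi"
    by (auto simp: lo_def hi_def min_def max_def)
  \<comment> \<open>The region between the two bands misses the frontier, so it is either disjoint from the image of the row or contained in it.\<close>
  let ?V = "rect (?o (x0 + 3/2 * M * l) (lo + e)) u w (4 * M * l) (hi - lo - 2 * e)"
  have measT: "measure lebesgue (f ` ?T) \<le> W * (4 * e + 2 * l / M)"
  proof (cases "hi - lo \<le> 4 * e - 2 * e + 2 * l / M")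
    case True
    have "f q \<in> rect (?o c (lo - e)) u w W (hi - lo + 2 * e)" if "q \<in> ?T" for q
      unfolding o_rect using width[OF that] heightT[OF that] by simp
    then have "measure lebesgue (f ` ?T) \<le> measure lebesgue (rect (?o c (lo - e)) u w W (hi - lo + 2 * e))"
      using comp(2) compact_rect[OF uw]
      by (intro measure_mono_fmeasurable fmeasurableD lmeasurable_compact) auto
    also have "\<dots> = W * (hi - lo + 2 * e)"
      using W0 hilo pos by (intro measure_rect[OF uw]) auto
    also have "\<dots> \<le> W * (4 * e + 2 * l / M)"
      using True W0 by (intro mult_left_mono) auto
    finally show ?thesis .
  next
    case False
    have e2: "hi - lo - 2 * e > 2 * l / M" "2 * l / M > 0"
      using False pos by auto
    have "?V \<inter> frontier (f ` ?R) = {}"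
    proof (intro equals0I)
      fix z assume "z \<in> ?V \<inter> frontier (f ` ?R)"
      then show False
        using band[of z] by (auto simp: o_rect lo_def hi_def min_def max_def abs_if split: if_splits)
    qed
    moreover have "connected ?V"
      by (intro convex_connected convex_rect)
    ultimately consider "?V \<inter> f ` ?R = {}" | "?V \<subseteq> f ` ?R"
      using connected_Int_frontier[of ?V "f ` ?R"] by blast
    then show ?thesis
    proof cases
      case 1
      have "f ` ?T \<subseteq> rect (?o c (lo - e)) u w W (2 * e) \<union> rect (?o c (hi - e)) u w W (2 * e)"
      proof
        fix z assume z: "z \<in> f ` ?T"
        then have "z \<notin> ?V"
          using 1 TR by blast
        then show "z \<in> rect (?o c (lo - e)) u w W (2 * e) \<union> rect (?o c (hi - e)) u w W (2 * e)"
          using z width heightT place small_sub by (force simp: o_rect)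
      qed
      then have "measure lebesgue (f ` ?T) \<le>
          measure lebesgue (rect (?o c (lo - e)) u w W (2 * e) \<union> rect (?o c (hi - e)) u w W (2 * e))"
        using comp(2) compact_rect[OF uw]
        by (intro measure_mono_fmeasurable fmeasurableD lmeasurable_compact compact_Un) auto
      also have "\<dots> \<le> measure lebesgue (rect (?o c (lo - e)) u w W (2 * e)) +
          measure lebesgue (rect (?o c (hi - e)) u w W (2 * e))"
        using compact_rect[OF uw] by (intro measure_Un_le fmeasurableD lmeasurable_compact)
      also have "\<dots> = W * (4 * e)"
        using W0 pos by (simp add: measure_rect[OF uw])
      also have "\<dots> \<le> W * (4 * e + 2 * l / M)"
        using W0 e2(2) by (intro mult_left_mono) auto
      finally show ?thesis .
    next
      case 2
      have "4 * M * l * (2 * l / M) < 4 * M * l * (hi - lo - 2 * e)"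
        using e2 pos by (intro mult_strict_left_mono) auto
      also have "\<dots> = measure lebesgue ?V"
        using order.trans[OF less_imp_le[OF e2(2)] less_imp_le[OF e2(1)]] pos by (intro measure_rect[OF uw, symmetric]) auto
      also have "\<dots> \<le> measure lebesgue (f ` ?R)"
        using 2 comp(1) compact_rect[OF uw]
        by (intro measure_mono_fmeasurable fmeasurableD lmeasurable_compact) auto
      also have "\<dots> \<le> 8 * l\<^sup>2"
        by (rule area_row)
      finally show ?thesis
        using pos by (simp add: power2_eq_square)
    qed
  qed
  also have "W * (4 * e + 2 * l / M) = (\<delta> * l) * (16 * M * e + 8 * l)"
    using pos by (simp add: W_def field_simps)
  also have "\<dots> < (\<delta> * l) * (14 * l)"
    using pos small(3) by (intro mult_strict_left_mono) auto
  finally show False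
    using area_small by (simp add: power2_eq_square)
qed

section \<open>Squares and their frames\<close>

lemma region_mem:
  "x \<in> region Q \<longleftrightarrow> fst Q $ 1 \<le> x $ 1 \<and> x $ 1 \<le> fst Q $ 1 + snd Q \<and> fst Q $ 2 \<le> x $ 2 \<and> x $ 2 \<le> fst Q $ 2 + snd Q"
  by (auto simp: region_def mem_box_cart forall_2)

definition inner_region :: "square \<Rightarrow> (real^2) set" where
  "inner_region Q = box (fst Q) (fst Q + vec (snd Q))"

lemma inner_region_mem:
  "x \<in> inner_region Q \<longleftrightarrow> fst Q $ 1 < x $ 1 \<and> x $ 1 < fst Q $ 1 + snd Q \<and> fst Q $ 2 < x $ 2 \<and> x $ 2 < fst Q $ 2 + snd Q"
  by (auto simp: inner_region_def mem_box_cart forall_2)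

lemma measure_region:
  assumes "0 \<le> snd Q"
  shows "measure lebesgue (region Q) = (snd Q)\<^sup>2"
  using assms content_cbox_cart[of "fst Q" "fst Q + vec (snd Q)"]
  by (simp add: region_def UNIV_2 interval_ne_empty_cart power2_eq_square)

lemma compact_region: "compact (region Q)"
  by (simp add: region_def)

text \<open>
  \<open>p\<close> is a corner of \<open>Q\<close>, and \<open>d\<close>, \<open>b\<close> are the two axis directions that point along the edges into \<open>Q\<close>. These
  eight frames (stated through the centre of \<open>Q\<close>) represent all edges of a square together with a side on
  which the square lies, so that no argument about edges has to distinguish bottom, top, left and right.
\<close>

definition corner_frame :: "square \<Rightarrow> real^2 \<Rightarrow> real^2 \<Rightarrow> real^2 \<Rightarrow> bool" where
  "corner_frame Q p d b \<longleftrightarrow>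
     (let e = axis 1 1; e' = axis 2 1 in
       (d \<in> {e, - e} \<and> b \<in> {e', - e'}) \<or> (d \<in> {e', - e'} \<and> b \<in> {e, - e})) \<and>
     fst Q + vec (snd Q / 2) = p + (snd Q / 2) *\<^sub>R (d + b)"

lemma axis_2_nth:
  "(axis 1 1 :: real^2) $ 1 = 1" "(axis 1 1 :: real^2) $ 2 = 0"
  "(axis 2 1 :: real^2) $ 1 = 0" "(axis 2 1 :: real^2) $ 2 = 1"
  by (simp_all add: axis_def)

lemma corner_frame_orthonormal: "corner_frame Q p d b \<Longrightarrow> orthonormal d b"
  by (auto simp: corner_frame_def orthonormal_def Let_def norm_eq_1 inner_2 axis_2_nth)

lemma corner_frame_swap: "corner_frame Q p d b \<Longrightarrow> corner_frame Q p b d"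
  by (auto simp: corner_frame_def Let_def add.commute)

lemma corner_frame_flip: "corner_frame Q p d b \<Longrightarrow> corner_frame Q (p + snd Q *\<^sub>R d) (- d) b"
  by (auto simp: corner_frame_def Let_def vec_eq_iff forall_2 axis_2_nth algebra_simps)

lemma corner_frame_exists: "corner_frame Q (fst Q) (axis 1 1) (axis 2 1)"
  by (simp add: corner_frame_def Let_def vec_eq_iff forall_2 axis_2_nth)

lemma corner_frame_region:
  "corner_frame Q p d b \<Longrightarrow> region Q = rect p d b (snd Q) (snd Q)"
  by (auto simp: corner_frame_def Let_def vec_eq_iff forall_2 axis_2_nth region_mem rect_def inner_2)

lemma corner_frame_inner_region:
  "corner_frame Q p d b \<Longrightarrow> inner_region Q = open_rect p d b (snd Q) (snd Q)"
  by (auto simp: corner_frame_def Let_def vec_eq_iff forall_2 axis_2_nth inner_region_mem open_rect_def inner_2)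

lemma corner_frame_concentric:
  assumes "corner_frame Q p d b"
  shows "corner_frame (concentric \<delta> Q) (p + ((1 - \<delta>) / 2 * snd Q) *\<^sub>R (d + b)) d b"
  using assms
  by (auto simp: corner_frame_def Let_def vec_eq_iff forall_2 axis_2_nth concentric_def algebra_simps
      diff_divide_distrib)

text \<open>
  Each edge of \<open>Q\<close> carries a row of \<open>n\<close> cells of the frame, which inherit its orientation. Depending on the
  frame the \<open>i\<close>-th cell is counted from either end of the row.
\<close>

lemma corner_frame_cell:
  assumes "corner_frame Q p d b" "i < n"
  obtains Q' where "Q' \<in> frame n Q" "snd Q' = snd Q / real n"
    "corner_frame Q' (p + (real i * (snd Q / real n)) *\<^sub>R d) d b"
proof -
  note result = that
  define c where "c = snd Q / real n"
  have n: "real n > 0" "real (n - 1 - i) = real n - 1 - real i" "real (n - 1) = real n - 1" 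
    using assms(2) by auto
  have Q: "snd Q = real n * c"
    using n by (simp add: c_def)
  have *: thesis if "k < n" "m < n" "k = 0 \<or> k = n - 1 \<or> m = 0 \<or> m = n - 1"
    "corner_frame (fst Q + c *\<^sub>R vector [real k, real m], c) (p + (real i * c) *\<^sub>R d) d b" for k m
    using that by (intro result[of "(fst Q + c *\<^sub>R vector [real k, real m], c)"])
      (auto simp: frame_def c_def)
  let ?e = "axis 1 1 :: real^2" and ?e' = "axis 2 1 :: real^2"
  consider "d = ?e" "b = ?e'" | "d = ?e" "b = - ?e'" | "d = - ?e" "b = ?e'" | "d = - ?e" "b = - ?e'"
    | "d = ?e'" "b = ?e" | "d = ?e'" "b = - ?e" | "d = - ?e'" "b = ?e" | "d = - ?e'" "b = - ?e"
    using assms(1) by (auto simp: corner_frame_def Let_def)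
  then show thesis
  proof cases
    case 1
    then show thesis
      using assms n Q by (intro *[of i 0]) (auto simp: corner_frame_def Let_def vec_eq_iff forall_2 axis_2_nth algebra_simps)
  next
    case 2
    then show thesis
      using assms n Q by (intro *[of i "n - 1"]) (auto simp: corner_frame_def Let_def vec_eq_iff forall_2 axis_2_nth algebra_simps)
  next
    case 3
    then show thesis
      using assms n Q by (intro *[of "n - 1 - i" 0]) (auto simp: corner_frame_def Let_def vec_eq_iff forall_2 axis_2_nth algebra_simps)
  next
    case 4
    then show thesis
      using assms n Q by (intro *[of "n - 1 - i" "n - 1"]) (auto simp: corner_frame_def Let_def vec_eq_iff forall_2 axis_2_nth algebra_simps)
  next
    case 5
    then show thesis
      using assms n Q by (intro *[of 0 i]) (auto simp: corner_frame_def Let_def vec_eq_iff forall_2 axis_2_nth algebra_simps)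
  next
    case 6
    then show thesis
      using assms n Q by (intro *[of "n - 1" i]) (auto simp: corner_frame_def Let_def vec_eq_iff forall_2 axis_2_nth algebra_simps)
  next
    case 7
    then show thesis
      using assms n Q by (intro *[of 0 "n - 1 - i"]) (auto simp: corner_frame_def Let_def vec_eq_iff forall_2 axis_2_nth algebra_simps)
  next
    case 8
    then show thesis
      using assms n Q by (intro *[of "n - 1" "n - 1 - i"]) (auto simp: corner_frame_def Let_def vec_eq_iff forall_2 axis_2_nth algebra_simps)
  qed
qed

lemma frame_cases:
  assumes "Q' \<in> frame n Q"
  obtains i k where "i < n" "k < n" "i = 0 \<or> i = n - 1 \<or> k = 0 \<or> k = n - 1" "snd Q' = snd Q / real n"
    "fst Q' $ 1 = fst Q $ 1 + real i * (snd Q / real n)" "fst Q' $ 2 = fst Q $ 2 + real k * (snd Q / real n)"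
    "Q' = (fst Q + (snd Q / real n) *\<^sub>R vector [real i, real k], snd Q / real n)"
proof -
  obtain i k where "Q' = (fst Q + (snd Q / real n) *\<^sub>R vector [real i, real k], snd Q / real n)"
       "i < n" "k < n" "i = 0 \<or> i = n - 1 \<or> k = 0 \<or> k = n - 1"
    using assms unfolding frame_def by blast
  then show thesis
    by (intro that[of i k]) auto
qed

lemma grid_cell_bounds:
  assumes "i < n" "0 \<le> (l::real)"
  shows "0 \<le> real i * (l / real n)" "real i * (l / real n) + l / real n \<le> l"
proof -
  have "real i * (l / real n) + l / real n = (real i + 1) * (l / real n)"
    by (simp add: algebra_simps add_divide_distrib)
  also have "\<dots> \<le> real n * (l / real n)"
    using assms by (intro mult_right_mono) auto
  finally show "real i * (l / real n) + l / real n \<le> l"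
    using assms by simp
qed (use assms in auto)

lemma frame_cell_subset:
  assumes "Q' \<in> frame n Q" "0 < snd Q"
  shows "0 < snd Q'" "region Q' \<subseteq> region Q" "inner_region Q' \<subseteq> inner_region Q"
proof -
  obtain i k where Q': "i < n" "k < n" "i = 0 \<or> i = n - 1 \<or> k = 0 \<or> k = n - 1" "snd Q' = snd Q / real n"
    "fst Q' $ 1 = fst Q $ 1 + real i * (snd Q / real n)" "fst Q' $ 2 = fst Q $ 2 + real k * (snd Q / real n)"
    "Q' = (fst Q + (snd Q / real n) *\<^sub>R vector [real i, real k], snd Q / real n)"
    by (rule frame_cases[OF assms(1)])
  show "0 < snd Q'"
    using Q' assms by simp
  note b = grid_cell_bounds[OF Q'(1) less_imp_le[OF assms(2)]] grid_cell_bounds[OF Q'(2) less_imp_le[OF assms(2)]]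
  show "region Q' \<subseteq> region Q"
    using b assms(2) by (intro subsetI, unfold region_mem Q'(4-6), elim conjE, intro conjI) linarith+
  show "inner_region Q' \<subseteq> inner_region Q"
    using b assms(2) by (intro subsetI, unfold inner_region_mem Q'(4-6), elim conjE, intro conjI) linarith+
qed

lemma grid_intervals_eq:
  fixes i k :: nat and a c x :: real
  assumes "0 < c" "a + real i * c < x" "x < a + real i * c + c" "a + real k * c < x" "x < a + real k * c + c"
  shows "i = k"
proof -
  have "real i * c < (real k + 1) * c" "real k * c < (real i + 1) * c"
    using assms by (simp_all add: algebra_simps)
  then have "real i < real k + 1" "real k < real i + 1"
    using assms(1) by (metis mult_less_cancel_right_pos)+
  then show "i = k"
    by linarith
qed

lemma frame_cells_disjoint:
  assumes "Q1 \<in> frame n Q" "Q2 \<in> frame n Q" "Q1 \<noteq> Q2" "0 < snd Q"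
  shows "inner_region Q1 \<inter> inner_region Q2 = {}"
proof (intro equals0I)
  fix x assume x: "x \<in> inner_region Q1 \<inter> inner_region Q2"
  obtain i k where 1: "i < n" "k < n" "i = 0 \<or> i = n - 1 \<or> k = 0 \<or> k = n - 1" "snd Q1 = snd Q / real n"
    "fst Q1 $ 1 = fst Q $ 1 + real i * (snd Q / real n)" "fst Q1 $ 2 = fst Q $ 2 + real k * (snd Q / real n)"
    "Q1 = (fst Q + (snd Q / real n) *\<^sub>R vector [real i, real k], snd Q / real n)"
    by (rule frame_cases[OF assms(1)])
  obtain i' k' where 2: "i' < n" "k' < n" "i' = 0 \<or> i' = n - 1 \<or> k' = 0 \<or> k' = n - 1" "snd Q2 = snd Q / real n"
    "fst Q2 $ 1 = fst Q $ 1 + real i' * (snd Q / real n)" "fst Q2 $ 2 = fst Q $ 2 + real k' * (snd Q / real n)"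
    "Q2 = (fst Q + (snd Q / real n) *\<^sub>R vector [real i', real k'], snd Q / real n)"
    by (rule frame_cases[OF assms(2)])
  have c: "0 < snd Q / real n"
    using 1(1) assms(4) by simp
  have "i \<noteq> i' \<or> k \<noteq> k'"
    using 1(7) 2(7) assms(3) by auto
  moreover have "i = i'"
    by (rule grid_intervals_eq[OF c, of "fst Q $ 1" _ "x $ 1"])
      (use x in \<open>auto simp: inner_region_mem 1(4-6) 2(4-6)\<close>)
  moreover have "k = k'"
    by (rule grid_intervals_eq[OF c, of "fst Q $ 2" _ "x $ 2"])
      (use x in \<open>auto simp: inner_region_mem 1(4-6) 2(4-6)\<close>)
  ultimately show False
    by simp
qed

lemma concentric_subset:
  assumes "0 < \<delta>" "\<delta> < 1" "0 < snd Q"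
  shows "region (concentric \<delta> Q) \<subseteq> inner_region Q" "0 < snd (concentric \<delta> Q)"
proof -
  have "0 < (1 - \<delta>) / 2 * snd Q" "(1 - \<delta>) / 2 * snd Q + \<delta> * snd Q < snd Q"
    using assms mult_pos_pos[of "1 - \<delta>" "snd Q"] by (auto simp: field_simps)
  then show "region (concentric \<delta> Q) \<subseteq> inner_region Q"
    unfolding subset_iff region_mem inner_region_mem by (auto simp: concentric_def)
qed (use assms in \<open>auto simp: concentric_def\<close>)

lemma inner_region_subset: "inner_region Q \<subseteq> region Q"
  by (auto simp: region_mem inner_region_mem)

text \<open>
  A frame of at least seven cells per side has width at most a seventh of the square, whereas the
  concentric square stays in the central part since \<open>\<delta> < 1 / 14\<close>.
\<close>

lemma concentric_frame_disjoint:
  assumes "0 < \<delta>" "\<delta> < 1 / 14" "0 < snd Q" "Q' \<in> frame n Q" "7 \<le> n"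
  shows "region (concentric \<delta> Q) \<inter> region Q' = {}"
proof (intro equals0I)
  fix x assume x: "x \<in> region (concentric \<delta> Q) \<inter> region Q'"
  obtain i k where Q': "i < n" "k < n" "i = 0 \<or> i = n - 1 \<or> k = 0 \<or> k = n - 1" "snd Q' = snd Q / real n"
    "fst Q' $ 1 = fst Q $ 1 + real i * (snd Q / real n)" "fst Q' $ 2 = fst Q $ 2 + real k * (snd Q / real n)"
    "Q' = (fst Q + (snd Q / real n) *\<^sub>R vector [real i, real k], snd Q / real n)"
    by (rule frame_cases[OF assms(4)])
  define l where "l = snd Q"
  have l: "0 < l" using assms(3) by (simp add: l_def)
  have n: "l / real n \<le> l / 7"
    using assms(5) l by (intro divide_left_mono) auto
  have n1: "real (n - 1) * (l / real n) = l - l / real n"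
    using assms(5) by (simp add: of_nat_diff field_simps)
  have "\<delta> * l < 1 / 14 * l"
    using assms(2) l by (intro mult_strict_right_mono) auto
  moreover have "(1 - \<delta>) / 2 * l = l / 2 - \<delta> * l / 2"
    by (simp add: field_simps)
  moreover have "(l / 2 - \<delta> * l / 2) + \<delta> * l = l / 2 + \<delta> * l / 2"
    by simp
  moreover have bounds: "fst Q $ m + (1 - \<delta>) / 2 * l \<le> x $ m" "x $ m \<le> fst Q $ m + (1 - \<delta>) / 2 * l + \<delta> * l"
    "fst Q' $ m \<le> x $ m" "x $ m \<le> fst Q' $ m + l / real n" for m
    using x Q'(4) exhaust_2[of m] unfolding Int_iff region_mem by (auto simp: concentric_def l_def)
  moreover obtain m where "fst Q' $ m = fst Q $ m \<or> fst Q' $ m + l / real n = fst Q $ m + l"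
  proof -
    have "fst Q' $ 1 = fst Q $ 1 \<or> fst Q' $ 1 + l / real n = fst Q $ 1 + l \<or>
        fst Q' $ 2 = fst Q $ 2 \<or> fst Q' $ 2 + l / real n = fst Q $ 2 + l"
      using Q'(3,5,6) n1 by (auto simp: l_def)
    then show thesis
      using that by blast
  qed
  ultimately show False
    using n l bounds[of m] by linarith
qed

lemma grid_index:
  fixes s c :: real
  assumes "0 \<le> s" "s \<le> real n * c" "0 < c" "1 \<le> n"
  obtains i where "i < n" "real i * c \<le> s" "s \<le> real (Suc i) * c"
proof (cases "s = real n * c")
  case True
  then show thesis
    using assms by (intro that[of "n - 1"]) (auto simp: mult_right_mono)
next
  case False
  let ?i = "nat \<lfloor>s / c\<rfloor>"
  have s: "0 \<le> s / c" "s / c < real n"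
    using False assms by (auto simp: field_simps)
  have i: "real ?i \<le> s / c" "s / c < real ?i + 1"
    using s by (auto simp: of_nat_floor)
  then have "?i < n"
    using s by (metis le_less_trans of_nat_less_iff)
  then show thesis
    using i pos_le_divide_eq[OF assms(3)] pos_divide_less_eq[OF assms(3)]
    by (intro that[of ?i]) (simp_all add: less_imp_le add.commute)
qed

definition frame_region :: "nat \<Rightarrow> square \<Rightarrow> (real^2) set" where
  "frame_region n Q = (\<Union>Q' \<in> frame n Q. region Q')"

lemma frame_bounded_by_4n:
  assumes "1 \<le> n"
  shows "finite (frame n Q)" "card (frame n Q) \<le> 4 * n"
proof -
  let ?c = "\<lambda>(i, k). (fst Q + (snd Q / real n) *\<^sub>R vector [real i, real k], snd Q / real n)"
  let ?I = "{0, n - 1} \<times> {..<n} \<union> {..<n} \<times> {0, n - 1}"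
  have sub: "frame n Q \<subseteq> ?c ` ?I"
  proof
    fix Q' assume "Q' \<in> frame n Q"
    then obtain i k where ik: "i < n" "k < n" "i = 0 \<or> i = n - 1 \<or> k = 0 \<or> k = n - 1"
      and "Q' = ?c (i, k)"
      by (rule frame_cases) simp
    then show "Q' \<in> ?c ` ?I"
      by (intro image_eqI[of _ _ "(i, k)"]) auto
  qed
  show "finite (frame n Q)"
    by (rule finite_subset[OF sub]) auto
  have "card (frame n Q) \<le> card (?c ` ?I)"
    by (rule card_mono[OF _ sub]) auto
  also have "\<dots> \<le> card ?I"
    by (rule card_image_le) auto
  also have "\<dots> \<le> card ({0, n - 1} \<times> {..<n}) + card ({..<n} \<times> {0, n - 1})"
    by (rule card_Un_le)
  also have "\<dots> \<le> 2 * n + n * 2"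
    unfolding card_cartesian_product
    by (intro add_mono mult_le_mono) (auto simp: card_insert_if)
  finally show "card (frame n Q) \<le> 4 * n" by simp
qed

lemma edge_subset_frame_region:
  assumes "x \<in> region Q - inner_region Q" "0 < snd Q" "1 \<le> n"
  shows "x \<in> frame_region n Q"
proof -
  obtain p d b where cf: "corner_frame Q p d b" and x: "(x - p) \<bullet> b = 0" "0 \<le> (x - p) \<bullet> d" "(x - p) \<bullet> d \<le> snd Q"
  proof -
    let ?e = "axis 1 1 :: real^2" and ?e' = "axis 2 1 :: real^2"
    have "x $ 1 = fst Q $ 1 \<or> x $ 1 = fst Q $ 1 + snd Q \<or> x $ 2 = fst Q $ 2 \<or> x $ 2 = fst Q $ 2 + snd Q"
      using assms(1) by (auto simp: region_mem inner_region_mem)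
    moreover have b: "fst Q $ 1 \<le> x $ 1" "x $ 1 \<le> fst Q $ 1 + snd Q" "fst Q $ 2 \<le> x $ 2" "x $ 2 \<le> fst Q $ 2 + snd Q"
      using assms(1) by (auto simp: region_mem)
    moreover note corner_frame_exists[of Q]
    ultimately show thesis
      using that[OF corner_frame_exists] that[OF corner_frame_swap[OF corner_frame_exists]]
        that[OF corner_frame_swap[OF corner_frame_flip[OF corner_frame_exists]]]
        that[OF corner_frame_swap[OF corner_frame_flip[OF corner_frame_swap[OF corner_frame_exists]]]]
      by (auto simp: inner_2 axis_2_nth)
  qed
  define c where "c = snd Q / real n"
  have c: "c > 0" "snd Q = real n * c" using assms by (auto simp: c_def)
  define s where "s = (x - p) \<bullet> d"
  obtain i where i: "i < n" "real i * c \<le> s" "s \<le> real (Suc i) * c"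
    using grid_index[of s n c] x c assms(3) unfolding s_def by auto
  obtain Q' where Q': "Q' \<in> frame n Q" "snd Q' = c" "corner_frame Q' (p + (real i * c) *\<^sub>R d) d b"
    using corner_frame_cell[OF cf i(1)] unfolding c_def by metis
  have "x \<in> region Q'"
    unfolding corner_frame_region[OF Q'(3)] Q'(2)
    using i x c orthonormal_inner[OF corner_frame_orthonormal[OF cf]]
    by (simp add: rect_def s_def inner_simps distrib_right)
  then show ?thesis
    using Q'(1) unfolding frame_region_def by blast
qed

section \<open>The hierarchy of squares\<close>

locale mcmullen_squares =
  fixes \<delta> \<gamma> :: real and h :: "nat \<Rightarrow> real"
  assumes \<delta>_pos: "0 < \<delta>" and \<delta>_less: "\<delta> < 1 / 14"
    and \<gamma>_pos: "0 < \<gamma>" and \<gamma>_less: "\<gamma> < 1 - 14 * \<delta>"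
    and admissible: "admissible \<gamma> h"
begin

text \<open>
  All squares of stage \<open>j\<close> whose edges are subdivided at the next stage.
\<close>

definition nodes :: "nat \<Rightarrow> square set" where
  "nodes j = squares \<delta> h j \<union> concentric \<delta> ` squares \<delta> h j"

definition subdiv :: "nat \<Rightarrow> nat" where
  "subdiv j = nat \<lfloor>ratio h j\<rfloor>"

lemma subdiv:
  assumes "2 \<le> j"
  shows "real (subdiv j) = ratio h j" "7 dvd subdiv j" "7 \<le> subdiv j"
proof -
  obtain m :: nat where "0 < m" "7 dvd m" "ratio h j = real m"
    using admissible assms unfolding admissible_def by blast
  then show "real (subdiv j) = ratio h j" "7 dvd subdiv j" "7 \<le> subdiv j"
    by (auto simp: subdiv_def dest: dvd_imp_le)
qed

lemma subdiv_at_top: "filterlim (\<lambda>j. real (subdiv j)) at_top sequentially"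
proof -
  have "filterlim (ratio h) at_top sequentially"
    using admissible by (simp add: admissible_def)
  moreover have "\<forall>\<^sub>F j in sequentially. real (subdiv j) = ratio h j"
    using eventually_ge_at_top[of 2] by eventually_elim (rule subdiv(1))
  ultimately show ?thesis
    by (simp add: filterlim_cong[OF refl refl])
qed

lemma squares_Suc:
  assumes "1 \<le> j"
  shows "squares \<delta> h (Suc j) = (\<Union>Q \<in> nodes j. frame (subdiv (Suc j)) Q)"
  using assms by (cases j) (simp_all add: nodes_def subdiv_def)

lemma nodes_cell:
  assumes "1 \<le> j" "Q \<in> nodes j" "Q' \<in> frame (subdiv (Suc j)) Q"
  shows "Q' \<in> squares \<delta> h (Suc j)" "Q' \<in> nodes (Suc j)"
proof -
  show "Q' \<in> squares \<delta> h (Suc j)"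
    unfolding squares_Suc[OF assms(1)] using assms(2,3) by blast
  then show "Q' \<in> nodes (Suc j)"
    unfolding nodes_def by blast
qed

lemma concentric_in_square:
  assumes "0 < snd Q"
  shows "0 < snd (concentric \<delta> Q)" "region (concentric \<delta> Q) \<subseteq> inner_region Q"
    "region (concentric \<delta> Q) \<subseteq> region Q"
  using concentric_subset[OF \<delta>_pos _ assms] \<delta>_less inner_region_subset[of Q] by auto

lemma nodes_cases:
  assumes "Q \<in> nodes j"
  obtains P where "P \<in> squares \<delta> h j" "Q = P \<or> Q = concentric \<delta> P"
  using assms unfolding nodes_def by blast

lemma squares_pos_subset:
  "Q \<in> squares \<delta> h j \<Longrightarrow> 0 < snd Q \<and> region Q \<subseteq> unit_square"
proof (induction j arbitrary: Q)
  case 0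
  then show ?case by simp
next
  case (Suc j)
  show ?case
  proof (cases "j = 0")
    case True
    then show ?thesis using Suc by simp
  next
    case False
    then obtain P where P: "P \<in> nodes j" "Q \<in> frame (subdiv (Suc j)) P"
      using Suc.prems squares_Suc[of j] by auto
    from P(1) obtain R where R: "R \<in> squares \<delta> h j" "P = R \<or> P = concentric \<delta> R"
      by (rule nodes_cases)
    have "0 < snd P" "region P \<subseteq> unit_square"
      using R Suc.IH[OF R(1)] concentric_in_square[of R] by auto
    then show ?thesis
      using frame_cell_subset[OF P(2)] by blast
  qed
qed

lemma nodes_pos_subset:
  assumes "Q \<in> nodes j"
  shows "0 < snd Q" "region Q \<subseteq> unit_square"
proof -
  from assms obtain P where "P \<in> squares \<delta> h j" "Q = P \<or> Q = concentric \<delta> P"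
    by (rule nodes_cases)
  then show "0 < snd Q" "region Q \<subseteq> unit_square"
    using squares_pos_subset[of P j] concentric_in_square[of P] by auto
qed

lemma concentric_cells_disjoint:
  assumes "P \<in> squares \<delta> h j" "Q1 \<in> frame (subdiv (Suc j)) P" "Q2 \<in> frame (subdiv (Suc j)) (concentric \<delta> P)" "1 \<le> j"
  shows "inner_region Q1 \<inter> inner_region Q2 = {}"
proof -
  have P: "0 < snd P" and n: "7 \<le> subdiv (Suc j)"
    using squares_pos_subset[OF assms(1)] assms(4) subdiv by auto
  show ?thesis
    using concentric_frame_disjoint[OF \<delta>_pos \<delta>_less P assms(2) n]
      frame_cell_subset(2)[OF assms(3) concentric_in_square(1)[OF P]]
      inner_region_subset[of Q1] inner_region_subset[of Q2]
    by blast
qed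

text \<open>
  Two distinct squares of a stage descend from distinct squares of the previous one, or lie in one frame, or one of them lies in the frame of
  a square and the other in the frame of its concentric square.
\<close>

lemma squares_disjoint:
  assumes "Q1 \<in> squares \<delta> h j" "Q2 \<in> squares \<delta> h j" "Q1 \<noteq> Q2"
  shows "inner_region Q1 \<inter> inner_region Q2 = {}"
  using assms
proof (induction j arbitrary: Q1 Q2)
  case 0
  then show ?case by simp
next
  case (Suc j)
  show ?case
  proof (cases "j = 0")
    case True
    then show ?thesis using Suc by simp
  next
    case False
    have parent: "\<exists>P R. P \<in> squares \<delta> h j \<and> (R = P \<or> R = concentric \<delta> P) \<and> Q \<in> frame (subdiv (Suc j)) R"
      if "Q \<in> squares \<delta> h (Suc j)" for Q
    proof -
      have "1 \<le> j" using False by simp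
      then obtain R where R: "R \<in> nodes j" "Q \<in> frame (subdiv (Suc j)) R"
        using \<open>Q \<in> squares \<delta> h (Suc j)\<close> unfolding squares_Suc[OF \<open>1 \<le> j\<close>] by blast
      from R(1) obtain P where "P \<in> squares \<delta> h j" "R = P \<or> R = concentric \<delta> P"
        by (rule nodes_cases)
      then show ?thesis using R(2) by blast
    qed
    obtain P1 R1 where 1: "P1 \<in> squares \<delta> h j" "R1 = P1 \<or> R1 = concentric \<delta> P1" "Q1 \<in> frame (subdiv (Suc j)) R1"
      using parent Suc.prems by blast
    obtain P2 R2 where 2: "P2 \<in> squares \<delta> h j" "R2 = P2 \<or> R2 = concentric \<delta> P2" "Q2 \<in> frame (subdiv (Suc j)) R2"
      using parent Suc.prems by blast
    have R: "R1 \<in> nodes j" "R2 \<in> nodes j"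
      using 1 2 by (auto simp: nodes_def)
    have pos: "0 < snd P1" "0 < snd P2"
      using squares_pos_subset 1(1) 2(1) by auto
    have "inner_region R1 \<subseteq> inner_region P1" "inner_region R2 \<subseteq> inner_region P2"
      using 1(2) 2(2) concentric_in_square(2)[OF pos(1)] concentric_in_square(2)[OF pos(2)]
        inner_region_subset[of R1] inner_region_subset[of R2] by auto
    then have sub: "inner_region Q1 \<subseteq> inner_region P1" "inner_region Q2 \<subseteq> inner_region P2"
      using frame_cell_subset(3)[OF 1(3) nodes_pos_subset(1)[OF R(1)]]
        frame_cell_subset(3)[OF 2(3) nodes_pos_subset(1)[OF R(2)]] by auto
    consider "P1 \<noteq> P2" | "R1 = R2" | "P1 = P2" "R1 = P1" "R2 = concentric \<delta> P1" | "P1 = P2" "R2 = P1" "R1 = concentric \<delta> P1"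
      using 1(2) 2(2) by blast
    then show ?thesis
    proof cases
      case 1
      then show ?thesis
        using Suc.IH[of P1 P2] sub \<open>P1 \<in> _\<close> \<open>P2 \<in> _\<close> by blast
    next
      case 2
      then show ?thesis
        using frame_cells_disjoint \<open>Q1 \<in> frame _ _\<close> \<open>Q2 \<in> frame _ _\<close> Suc.prems(3) nodes_pos_subset(1)[OF R(1)] by blast
    next
      case 3
      then show ?thesis
        using concentric_cells_disjoint[OF \<open>P1 \<in> _\<close>, of Q1 Q2] \<open>Q1 \<in> frame _ _\<close> \<open>Q2 \<in> frame _ _\<close> False by simp
    next
      case 4
      then show ?thesis
        using concentric_cells_disjoint[OF \<open>P1 \<in> _\<close>, of Q2 Q1] \<open>Q1 \<in> frame _ _\<close> \<open>Q2 \<in> frame _ _\<close> False by auto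
    qed
  qed
qed

lemma inner_region_unique:
  assumes "Q \<in> squares \<delta> h j" "P \<in> squares \<delta> h j" "x \<in> inner_region Q" "x \<in> region P"
  shows "P = Q"
proof (rule ccontr)
  assume "P \<noteq> Q"
  then have "inner_region Q \<inter> inner_region P = {}"
    using squares_disjoint assms by blast
  then have "inner_region Q \<inter> closure (inner_region P) = {}"
    using open_Int_closure_eq_empty[of "inner_region Q" "inner_region P"] open_box
    unfolding inner_region_def by blast
  moreover have "closure (inner_region P) = region P"
    using squares_pos_subset[OF assms(2)] by (simp add: inner_region_def region_def interval_ne_empty_cart)
  ultimately show False
    using assms by blast
qed

lemma S_union_Suc:
  assumes "1 \<le> j"
  shows "S_union \<delta> h (Suc j) = (\<Union>Q \<in> nodes j. frame_region (subdiv (Suc j)) Q)"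
  using squares_Suc[OF assms] by (auto simp: S_union_def frame_region_def)

lemma frame_region_subset:
  "0 < snd Q \<Longrightarrow> frame_region n Q \<subseteq> region Q"
  unfolding frame_region_def using frame_cell_subset(2) by blast

lemma S_union_Suc_subset:
  assumes "1 \<le> j"
  shows "S_union \<delta> h (Suc j) \<subseteq> S_union \<delta> h j"
proof
  fix x assume "x \<in> S_union \<delta> h (Suc j)"
  then obtain Q where Q: "Q \<in> nodes j" "x \<in> region Q"
    using S_union_Suc[OF assms] frame_region_subset nodes_pos_subset(1) by blast
  from Q(1) obtain P where P: "P \<in> squares \<delta> h j" "Q = P \<or> Q = concentric \<delta> P"
    by (rule nodes_cases)
  then have "x \<in> region P"
    using Q(2) squares_pos_subset[OF P(1)] concentric_in_square(3)[of P] by auto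
  then show "x \<in> S_union \<delta> h j"
    using P(1) by (auto simp: S_union_def)
qed

text \<open>
  Off the next stage the approximants never change again, because the unions of the squares of the stages
  decrease. The limit that defines the density is hence eventually constant there.
\<close>

lemma density_between_stages:
  assumes "1 \<le> j" "x \<in> S_union \<delta> h j" "x \<notin> S_union \<delta> h (Suc j)"
  shows "mcmullen_density \<delta> \<gamma> h t1 s1 x =
    (if x \<in> T_union \<delta> h j then t_const \<delta> \<gamma> h (Suc j) else s_const \<delta> \<gamma> h (Suc j))" (is "_ = ?c")
proof -
  have *: "approx_density \<delta> \<gamma> h t1 s1 k x = ?c \<and> x \<notin> S_union \<delta> h k" if "Suc j \<le> k" for k
    using that
  proof (induction k rule: dec_induct)
    case base
    then show ?case
      using assms by (cases j) auto
  next
    case (step k)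
    then show ?case
      using S_union_Suc_subset[of k] by (cases k) auto
  qed
  have "(\<lambda>k. approx_density \<delta> \<gamma> h t1 s1 k x) \<longlonglongrightarrow> ?c"
    by (rule tendsto_eventually, unfold eventually_sequentially) (use * in blast)
  then show ?thesis
    unfolding mcmullen_density_def by (rule limI)
qed

lemma square_minus_S_union:
  assumes "1 \<le> j" "Q \<in> squares \<delta> h j" "x \<in> region Q" "x \<notin> S_union \<delta> h (Suc j)"
  shows "x \<in> inner_region Q" "x \<in> T_union \<delta> h j \<longleftrightarrow> x \<in> region (concentric \<delta> Q)"
proof -
  have Q: "0 < snd Q" "Q \<in> nodes j"
    using squares_pos_subset assms(2) by (auto simp: nodes_def)
  show x: "x \<in> inner_region Q"
  proof (rule ccontr)
    assume "x \<notin> inner_region Q"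
    then have "x \<in> frame_region (subdiv (Suc j)) Q"
      using assms(3) by (intro edge_subset_frame_region Q(1)) (use subdiv(3)[of "Suc j"] assms(1) in auto)
    then show False
      using S_union_Suc[OF assms(1)] Q(2) assms(4) by blast
  qed
  have "P = Q" if "P \<in> squares \<delta> h j" "x \<in> region (concentric \<delta> P)" for P
  proof -
    have "x \<in> region P"
      using that(2) concentric_in_square(3)[of P] squares_pos_subset[OF that(1)] by auto
    then show ?thesis
      using inner_region_unique[OF assms(2) that(1) x] by simp
  qed
  then show "x \<in> T_union \<delta> h j \<longleftrightarrow> x \<in> region (concentric \<delta> Q)"
    using assms(2) by (auto simp: T_union_def)
qed

text \<open>
  Since the squares of a stage do not overlap, a square meets the next stage only in its own two frames;
  points on its boundary belong to its own frame as well.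
\<close>

lemma square_Int_S_union:
  assumes "1 \<le> j" "Q \<in> squares \<delta> h j"
  shows "region Q \<inter> S_union \<delta> h (Suc j) \<subseteq>
      frame_region (subdiv (Suc j)) Q \<union> frame_region (subdiv (Suc j)) (concentric \<delta> Q)"
    and "region (concentric \<delta> Q) \<inter> S_union \<delta> h (Suc j) \<subseteq> frame_region (subdiv (Suc j)) (concentric \<delta> Q)"
proof -
  have n: "7 \<le> subdiv (Suc j)" and Q: "0 < snd Q"
    using subdiv assms squares_pos_subset by auto
  have *: "x \<in> frame_region (subdiv (Suc j)) Q \<union> frame_region (subdiv (Suc j)) (concentric \<delta> Q)"
    if x: "x \<in> inner_region Q" "x \<in> S_union \<delta> h (Suc j)" for x
  proof -
    obtain P R where P: "P \<in> squares \<delta> h j" "R = P \<or> R = concentric \<delta> P" "x \<in> frame_region (subdiv (Suc j)) R"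
    proof -
      obtain R where R: "R \<in> nodes j" "x \<in> frame_region (subdiv (Suc j)) R"
        using x(2) unfolding S_union_Suc[OF assms(1)] by blast
      from R(1) obtain P where "P \<in> squares \<delta> h j" "R = P \<or> R = concentric \<delta> P"
        by (rule nodes_cases)
      then show thesis using that R(2) by blast
    qed
    have pos: "0 < snd P" "0 < snd R"
      using P(2) squares_pos_subset[OF P(1)] concentric_in_square(1)[of P] by auto
    have "region R \<subseteq> region P"
      using P(2) concentric_in_square(3)[OF pos(1)] by auto
    then have "x \<in> region P"
      using P(3) frame_region_subset[OF pos(2)] by auto
    then have "P = Q"
      using inner_region_unique[OF assms(2) P(1) x(1)] by simp
    then show ?thesis
      using P by blast
  qed
  show "region Q \<inter> S_union \<delta> h (Suc j) \<subseteq>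
      frame_region (subdiv (Suc j)) Q \<union> frame_region (subdiv (Suc j)) (concentric \<delta> Q)"
  proof
    fix x assume x: "x \<in> region Q \<inter> S_union \<delta> h (Suc j)"
    show "x \<in> frame_region (subdiv (Suc j)) Q \<union> frame_region (subdiv (Suc j)) (concentric \<delta> Q)"
    proof (cases "x \<in> inner_region Q")
      case True
      then show ?thesis using * x by blast
    next
      case False
      then show ?thesis
        using x edge_subset_frame_region[OF _ Q, of x "subdiv (Suc j)"] n by auto
    qed
  qed
  show "region (concentric \<delta> Q) \<inter> S_union \<delta> h (Suc j) \<subseteq> frame_region (subdiv (Suc j)) (concentric \<delta> Q)"
  proof
    fix x assume x: "x \<in> region (concentric \<delta> Q) \<inter> S_union \<delta> h (Suc j)"
    then have "x \<in> inner_region Q"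
      using concentric_in_square(2)[OF Q] by auto
    moreover have "x \<notin> frame_region (subdiv (Suc j)) Q"
      using x concentric_frame_disjoint[OF \<delta>_pos \<delta>_less Q _ n] unfolding frame_region_def by blast
    ultimately show "x \<in> frame_region (subdiv (Suc j)) (concentric \<delta> Q)"
      using * x by blast
  qed
qed

end

section \<open>The maximal stretch of edges\<close>

lemma grid_chain:
  fixes g :: "real \<Rightarrow> 'a::real_normed_vector"
  assumes "\<And>i. i < n \<Longrightarrow> norm (g (real (Suc i) * c) - g (real i * c)) \<le> M * c"
    and "i \<le> k" "k \<le> n"
  shows "norm (g (real k * c) - g (real i * c)) \<le> M * (real k * c - real i * c)"
  using assms(2,3)
proof (induction k rule: dec_induct)
  case base
  then show ?case by simp
next
  case (step k)
  have "norm (g (real (Suc k) * c) - g (real i * c)) \<le>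
      norm (g (real (Suc k) * c) - g (real k * c)) + norm (g (real k * c) - g (real i * c))"
    using norm_triangle_ineq[of "g (real (Suc k) * c) - g (real k * c)" "g (real k * c) - g (real i * c)"] by simp
  also have "\<dots> \<le> M * c + M * (real k * c - real i * c)"
    using step assms(1)[of k] by auto
  finally show ?case
    by (simp add: algebra_simps)
qed

text \<open>
  If \<open>g\<close> is Lipschitz on the grid, with error \<open>e\<close> inside each cell, then two arbitrary points pick up at most
  two errors, one in each of their cells. In the application the error of a cell is proportional to its size,
  so that the total error at least halves when an edge is subdivided into four or more cells.
\<close>

lemma grid_almost_lipschitz:
  fixes g :: "real \<Rightarrow> 'a::real_normed_vector"
  assumes grid: "\<And>i. i < n \<Longrightarrow> norm (g (real (Suc i) * c) - g (real i * c)) \<le> M * c"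
    and cell: "\<And>i s t. i < n \<Longrightarrow> real i * c \<le> s \<Longrightarrow> s \<le> t \<Longrightarrow> t \<le> real (Suc i) * c \<Longrightarrow>
      norm (g t - g s) \<le> M * (t - s) + e"
    and c: "0 < c" "1 \<le> n" "0 \<le> e" and st: "0 \<le> s" "s \<le> t" "t \<le> real n * c"
  shows "norm (g t - g s) \<le> M * (t - s) + 2 * e"
proof -
  obtain i where i: "i < n" "real i * c \<le> s" "s \<le> real (Suc i) * c"
    using grid_index[of s n c] c st by auto
  obtain k where k: "k < n" "real k * c \<le> t" "t \<le> real (Suc k) * c"
    using grid_index[of t n c] c st by auto
  show ?thesis
  proof (cases "t \<le> real (Suc i) * c")
    case True
    then show ?thesis
      using cell[OF i(1,2) st(2)] c(3) by auto
  next
    case False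
    then have "real (Suc i) * c < real (Suc k) * c"
      using k by linarith
    then have ik: "Suc i \<le> k"
      using c(1) by (metis less_Suc_eq_le mult_less_cancel_right_pos of_nat_less_iff)
    have 1: "norm (g t - g (real k * c)) \<le> M * (t - real k * c) + e"
      using cell[OF k(1) order.refl k(2,3)] .
    have 2: "norm (g (real (Suc i) * c) - g s) \<le> M * (real (Suc i) * c - s) + e"
      using cell[OF i order.refl] .
    have 3: "norm (g (real k * c) - g (real (Suc i) * c)) \<le> M * (real k * c - real (Suc i) * c)"
      using grid_chain[of n g c M "Suc i" k] grid ik k(1) by auto
    have "g t - g s = (g t - g (real k * c)) + (g (real k * c) - g (real (Suc i) * c)) + (g (real (Suc i) * c) - g s)"
      by simp
    then have "norm (g t - g s) \<le> norm (g t - g (real k * c)) + norm (g (real k * c) - g (real (Suc i) * c))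
        + norm (g (real (Suc i) * c) - g s)"
      by (metis norm_triangle_ineq norm_triangle_mono order.refl)
    also have "\<dots> \<le> (M * (t - real k * c) + e) + M * (real k * c - real (Suc i) * c) + (M * (real (Suc i) * c - s) + e)"
      using 1 2 3 by (intro add_mono)
    finally show ?thesis
      by (simp add: algebra_simps)
  qed
qed

locale mcmullen_map = mcmullen_squares +
  fixes \<phi> :: "real^2 \<Rightarrow> real^2" and L :: real
  assumes L_pos: "0 < L" and lipschitz: "L-lipschitz_on unit_square \<phi>"
    and injective: "inj_on \<phi> unit_square"
begin

definition stretches :: "real set" where
  "stretches = {norm (\<phi> (p + snd Q *\<^sub>R d) - \<phi> p) / snd Q | Q p d b j. 1 \<le> j \<and> Q \<in> nodes j \<and> corner_frame Q p d b}"

definition M :: real where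
  "M = Sup stretches"

lemma lipschitz_norm:
  "x \<in> unit_square \<Longrightarrow> y \<in> unit_square \<Longrightarrow> norm (\<phi> x - \<phi> y) \<le> L * norm (x - y)"
  using lipschitz_onD[OF lipschitz] by (simp add: dist_norm)

lemma corner_frame_mem:
  assumes "corner_frame Q p d b" "0 \<le> s" "s \<le> snd Q" "0 \<le> t" "t \<le> snd Q"
  shows "p + s *\<^sub>R d + t *\<^sub>R b \<in> region Q"
  unfolding corner_frame_region[OF assms(1)]
  using rect_mem[OF corner_frame_orthonormal[OF assms(1)]] assms by simp

lemma edge_norm_le:
  assumes "Q \<in> nodes j" "corner_frame Q p d b" "0 \<le> s" "s \<le> t" "t \<le> snd Q"
  shows "norm (\<phi> (p + t *\<^sub>R d) - \<phi> (p + s *\<^sub>R d)) \<le> L * (t - s)"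
proof -
  have "p + t *\<^sub>R d \<in> unit_square" "p + s *\<^sub>R d \<in> unit_square"
    using corner_frame_mem[OF assms(2), of t 0] corner_frame_mem[OF assms(2), of s 0] assms(3-5)
      nodes_pos_subset[OF assms(1)] by auto
  moreover have "(p + t *\<^sub>R d) - (p + s *\<^sub>R d) = (t - s) *\<^sub>R d"
    by (simp add: algebra_simps)
  moreover have "norm d = 1"
    using corner_frame_orthonormal[OF assms(2)] by (simp add: orthonormal_def)
  ultimately show ?thesis
    using lipschitz_norm[of "p + t *\<^sub>R d" "p + s *\<^sub>R d"] assms(4) by simp
qed

lemma stretches_bounded: "bdd_above stretches"
proof (rule bdd_aboveI)
  fix r assume "r \<in> stretches"
  then obtain Q p d b j where Q: "Q \<in> nodes j" "corner_frame Q p d b" "r = norm (\<phi> (p + snd Q *\<^sub>R d) - \<phi> p) / snd Q"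
    unfolding stretches_def by blast
  have "0 < snd Q"
    using nodes_pos_subset Q by simp
  then show "r \<le> L"
    using edge_norm_le[OF Q(1,2), of 0 "snd Q"] Q(3) by (simp add: pos_divide_le_eq)
qed

lemma chord_le:
  assumes "1 \<le> j" "Q \<in> nodes j" "corner_frame Q p d b"
  shows "norm (\<phi> (p + snd Q *\<^sub>R d) - \<phi> p) \<le> M * snd Q"
proof -
  have "norm (\<phi> (p + snd Q *\<^sub>R d) - \<phi> p) / snd Q \<in> stretches"
    unfolding stretches_def using assms by blast
  then have "norm (\<phi> (p + snd Q *\<^sub>R d) - \<phi> p) / snd Q \<le> M"
    unfolding M_def using stretches_bounded by (rule cSup_upper)
  then show ?thesis
    using nodes_pos_subset(1)[OF assms(2)] by (simp add: field_simps)
qed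

lemma root_node: "(0, 1) \<in> nodes 1"
  by (simp add: nodes_def)

lemma M_pos: "0 < M"
proof -
  let ?e = "axis 1 1 :: real^2"
  have cf: "corner_frame (0, 1) 0 ?e (axis 2 1)"
    using corner_frame_exists[of "(0, 1)"] by simp
  have "0 + 1 *\<^sub>R ?e \<in> unit_square" "0 \<in> unit_square"
    using corner_frame_mem[OF cf, of 1 0] corner_frame_mem[OF cf, of 0 0] by auto
  then have "\<phi> (0 + 1 *\<^sub>R ?e) \<noteq> \<phi> 0"
    using inj_onD[OF injective, of "0 + 1 *\<^sub>R ?e" 0] by auto
  then have "0 < norm (\<phi> (0 + 1 *\<^sub>R ?e) - \<phi> 0)"
    by simp
  also have "\<dots> \<le> M * 1"
    using chord_le[OF _ root_node cf] by simp
  finally show ?thesis by simp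
qed

text \<open>
  Each use of the subdivision halves the error term, since there are at least four cells on an edge. The
  start of the induction is the Lipschitz constant of \<open>\<phi>\<close>.
\<close>

lemma edge_almost_lipschitz:
  assumes "1 \<le> j" "Q \<in> nodes j" "corner_frame Q p d b" "0 \<le> s" "s \<le> t" "t \<le> snd Q"
  shows "norm (\<phi> (p + t *\<^sub>R d) - \<phi> (p + s *\<^sub>R d)) \<le> M * (t - s) + L * snd Q * (1/2) ^ k"
  using assms
proof (induction k arbitrary: j Q p s t)
  case 0
  have "L * (t - s) \<le> L * snd Q"
    using 0 L_pos by (intro mult_left_mono) auto
  moreover have "0 \<le> M * (t - s)"
    using 0 M_pos by simp
  ultimately show ?case
    using edge_norm_le[OF 0(2-6)] by simp
next
  case (Suc k)
  define n c where "n = subdiv (Suc j)" and "c = snd Q / real n"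
  have n: "7 \<le> n"
    using subdiv Suc.prems(1) by (simp add: n_def)
  have Q: "0 < snd Q" "snd Q = real n * c" "0 < c"
    using nodes_pos_subset(1)[OF Suc.prems(2)] n by (auto simp: c_def)
  define g where "g = (\<lambda>s. \<phi> (p + s *\<^sub>R d))"
  have cell: "\<exists>Q'. Q' \<in> nodes (Suc j) \<and> snd Q' = c \<and> corner_frame Q' (p + (real i * c) *\<^sub>R d) d b" if "i < n" for i
    using corner_frame_cell[OF Suc.prems(3) that] nodes_cell(2)[OF Suc.prems(1,2)]
    unfolding n_def c_def by metis
  have "norm (g t - g s) \<le> M * (t - s) + 2 * (L * c * (1/2) ^ k)"
  proof (rule grid_almost_lipschitz)
    fix i assume "i < n"
    then obtain Q' where Q': "Q' \<in> nodes (Suc j)" "snd Q' = c" "corner_frame Q' (p + (real i * c) *\<^sub>R d) d b"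
      using cell by blast
    show "norm (g (real (Suc i) * c) - g (real i * c)) \<le> M * c"
      using chord_le[OF _ Q'(1,3)] Q'(2) by (simp add: g_def algebra_simps)
    fix s t assume st: "real i * c \<le> s" "s \<le> t" "t \<le> real (Suc i) * c"
    then have "norm (\<phi> (p + (real i * c) *\<^sub>R d + (t - real i * c) *\<^sub>R d) - \<phi> (p + (real i * c) *\<^sub>R d + (s - real i * c) *\<^sub>R d))
      \<le> M * ((t - real i * c) - (s - real i * c)) + L * snd Q' * (1/2) ^ k"
      by (intro Suc.IH[OF _ Q'(1,3)]) (auto simp: Q'(2) algebra_simps)
    then show "norm (g t - g s) \<le> M * (t - s) + L * c * (1/2) ^ k"
      by (simp add: g_def Q'(2) scaleR_left_diff_distrib)
  qed (use Suc.prems Q n L_pos in auto)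
  also have "2 * (L * c * (1/2) ^ k) \<le> L * snd Q * (1/2) ^ Suc k"
  proof -
    have "4 * c \<le> real n * c"
      using n Q(3) by (intro mult_right_mono) auto
    then have "(L * (1/2) ^ k) * (4 * c) \<le> (L * (1/2) ^ k) * snd Q"
      using L_pos Q(2) by (intro mult_left_mono) auto
    then show ?thesis
      by (simp add: algebra_simps)
  qed
  finally show ?case
    by (simp add: g_def)
qed

lemma edge_lipschitz:
  assumes "1 \<le> j" "Q \<in> nodes j" "corner_frame Q p d b"
  shows "M-lipschitz_on {0..snd Q} (\<lambda>s. \<phi> (p + s *\<^sub>R d))"
proof -
  have *: "norm (\<phi> (p + t *\<^sub>R d) - \<phi> (p + s *\<^sub>R d)) \<le> M * (t - s)" if "0 \<le> s" "s \<le> t" "t \<le> snd Q" for s t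
  proof (rule LIMSEQ_le_const)
    have "(\<lambda>k. M * (t - s) + L * snd Q * (1/2) ^ k) \<longlonglongrightarrow> M * (t - s) + L * snd Q * 0"
      by (intro tendsto_intros) auto
    then show "(\<lambda>k. M * (t - s) + L * snd Q * (1/2) ^ k) \<longlonglongrightarrow> M * (t - s)"
      by simp
  qed (use edge_almost_lipschitz[OF assms that] in auto)
  show ?thesis
  proof (rule lipschitz_onI)
    fix s t assume "s \<in> {0..snd Q}" "t \<in> {0..snd Q}"
    then show "dist (\<phi> (p + s *\<^sub>R d)) (\<phi> (p + t *\<^sub>R d)) \<le> M * dist s t"
      using *[of s t] *[of t s] by (cases "s \<le> t") (auto simp: dist_norm norm_minus_commute abs_if)
  qed (use M_pos in simp)
qed

lemma edge_le:
  assumes "1 \<le> j" "Q \<in> nodes j" "corner_frame Q p d b" "0 \<le> s" "s \<le> snd Q"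
  shows "norm (\<phi> (p + s *\<^sub>R d) - \<phi> p) \<le> M * s"
  using lipschitz_onD[OF edge_lipschitz[OF assms(1-3)], of s 0] assms(4,5) by (simp add: dist_norm)

text \<open>
  Every boundary point of a square is reached from a corner along at most two edges.
\<close>

lemma square_edge_distance:
  assumes "1 \<le> j" "Q \<in> nodes j" "corner_frame Q p d b"
    and q_edge: "q \<in> region Q - inner_region Q"
  shows "norm (\<phi> q - \<phi> p) \<le> 2 * M * snd Q"
proof -
  have db: "orthonormal d b"
    by (rule corner_frame_orthonormal[OF assms(3)])
  have q: "q \<in> rect p d b (snd Q) (snd Q) - open_rect p d b (snd Q) (snd Q)"
    using q_edge corner_frame_region[OF assms(3)] corner_frame_inner_region[OF assms(3)] by simp
  have l: "0 < snd Q"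
    by (rule nodes_pos_subset(1)[OF assms(2)])
  have two: "norm (\<phi> (p + snd Q *\<^sub>R e + s *\<^sub>R f) - \<phi> p) \<le> 2 * M * snd Q"
    if cf: "corner_frame Q p e f" and s: "0 \<le> s" "s \<le> snd Q" for e f s
  proof -
    have "norm (\<phi> (p + snd Q *\<^sub>R e + s *\<^sub>R f) - \<phi> p) \<le>
        norm (\<phi> (p + snd Q *\<^sub>R e + s *\<^sub>R f) - \<phi> (p + snd Q *\<^sub>R e)) + norm (\<phi> (p + snd Q *\<^sub>R e) - \<phi> p)"
      using norm_triangle_ineq[of "\<phi> (p + snd Q *\<^sub>R e + s *\<^sub>R f) - \<phi> (p + snd Q *\<^sub>R e)" "\<phi> (p + snd Q *\<^sub>R e) - \<phi> p"] by simp
    also have "\<dots> \<le> M * s + M * snd Q"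
      using edge_le[OF assms(1,2) corner_frame_swap[OF corner_frame_flip[OF cf]] s] chord_le[OF assms(1,2) cf] by auto
    also have "M * s \<le> M * snd Q"
      using s M_pos by (intro mult_left_mono) auto
    finally show ?thesis by (simp add: algebra_simps)
  qed
  have one: "norm (\<phi> (p + s *\<^sub>R e) - \<phi> p) \<le> 2 * M * snd Q"
    if cf: "corner_frame Q p e f" and s: "0 \<le> s" "s \<le> snd Q" for e f s
  proof -
    have "M * s \<le> M * (2 * snd Q)"
      using s M_pos by (intro mult_left_mono) auto
    then show ?thesis
      using edge_le[OF assms(1,2) cf s] by simp
  qed
  obtain s t where st: "q = p + s *\<^sub>R d + t *\<^sub>R b" "0 \<le> s" "s \<le> snd Q" "0 \<le> t" "t \<le> snd Q"
    using q orthonormal_rect_cases[OF db] by blast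
  then have "\<not> (0 < s \<and> s < snd Q \<and> 0 < t \<and> t < snd Q)"
    using q open_rect_mem[OF db] by blast
  then consider "s = 0" | "t = 0" | "s = snd Q" | "t = snd Q"
    using st by force
  then show ?thesis
  proof cases
    case 1
    then show ?thesis
      using one[OF corner_frame_swap[OF assms(3)] st(4,5)] st(1) by simp
  next
    case 2
    then show ?thesis
      using one[OF assms(3) st(2,3)] st(1) by simp
  next
    case 3
    then show ?thesis
      using two[OF assms(3) st(4,5)] st(1) by simp
  next
    case 4
    have "q = p + snd Q *\<^sub>R b + s *\<^sub>R d"
      using 4 st(1) by (simp add: algebra_simps)
    then show ?thesis
      using two[OF corner_frame_swap[OF assms(3)] st(2,3)] by simp
  qed
qed

text \<open>
  The displacement along an edge is the sum of the displacements along its cells, so one of them is stretched at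
  least as much. This moves a nearly maximal edge to arbitrarily deep stages.
\<close>

lemma stretched_cell:
  assumes "1 \<le> j" "Q \<in> nodes j" "corner_frame Q p d b" "r * snd Q < norm (\<phi> (p + snd Q *\<^sub>R d) - \<phi> p)"
  obtains Q' p' where "Q' \<in> nodes (Suc j)" "corner_frame Q' p' d b" "r * snd Q' < norm (\<phi> (p' + snd Q' *\<^sub>R d) - \<phi> p')"
proof (rule ccontr)
  assume no: "\<not> thesis"
  note result = that
  define n c where "n = subdiv (Suc j)" and "c = snd Q / real n"
  have n: "7 \<le> n"
    using subdiv assms(1) by (simp add: n_def)
  have Q: "snd Q = real n * c"
    using n by (simp add: c_def)
  define g where "g = (\<lambda>s. \<phi> (p + s *\<^sub>R d))"
  have "norm (g (real (Suc i) * c) - g (real i * c)) \<le> r * c" if "i < n" for i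
  proof -
    obtain Q' where Q': "Q' \<in> frame n Q" "snd Q' = c" "corner_frame Q' (p + (real i * c) *\<^sub>R d) d b"
      using corner_frame_cell[OF assms(3) \<open>i < n\<close>] unfolding c_def by metis
    then have "Q' \<in> nodes (Suc j)"
      using nodes_cell(2)[OF assms(1,2)] by (simp add: n_def)
    then have "\<not> r * snd Q' < norm (\<phi> (p + (real i * c) *\<^sub>R d + snd Q' *\<^sub>R d) - \<phi> (p + (real i * c) *\<^sub>R d))"
      using no result Q'(3) by blast
    then show ?thesis
      by (simp add: g_def Q'(2) algebra_simps)
  qed
  then have "norm (g (real n * c) - g (real 0 * c)) \<le> r * (real n * c - real 0 * c)"
    by (rule grid_chain[where n = n]) simp_all
  then show False
    using assms(4) by (simp add: g_def Q)
qed

lemma nearly_maximal_edge: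
  assumes "r < M"
  obtains Q p d b j where "J \<le> j" "1 \<le> j" "Q \<in> nodes j" "corner_frame Q p d b"
    "r * snd Q < norm (\<phi> (p + snd Q *\<^sub>R d) - \<phi> p)"
proof -
  have ne: "stretches \<noteq> {}"
    using root_node corner_frame_exists unfolding stretches_def by blast
  obtain x where "x \<in> stretches" "r < x"
    using assms less_cSup_iff[OF ne stretches_bounded] unfolding M_def by blast
  then obtain Q0 p0 d0 b0 j0 where 0: "1 \<le> j0" "Q0 \<in> nodes j0" "corner_frame Q0 p0 d0 b0"
    and "r < norm (\<phi> (p0 + snd Q0 *\<^sub>R d0) - \<phi> p0) / snd Q0"
    unfolding stretches_def by blast
  then have "r * snd Q0 < norm (\<phi> (p0 + snd Q0 *\<^sub>R d0) - \<phi> p0)"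
    using nodes_pos_subset(1)[OF 0(2)] by (simp add: field_simps)
  with 0 have "\<exists>Q p. Q \<in> nodes (j0 + k) \<and> corner_frame Q p d0 b0 \<and> r * snd Q < norm (\<phi> (p + snd Q *\<^sub>R d0) - \<phi> p)" for k
  proof (induction k)
    case 0
    then show ?case unfolding add_0_right by blast
  next
    case (Suc k)
    then obtain Q p where "Q \<in> nodes (j0 + k)" "corner_frame Q p d0 b0" "r * snd Q < norm (\<phi> (p + snd Q *\<^sub>R d0) - \<phi> p)"
      by blast
    then show ?case
      using stretched_cell[of "j0 + k" Q p d0 b0 r] 0(1) by (metis add_Suc_right trans_le_add1)
  qed
  from this[of J] show thesis
    using that[of "j0 + J"] 0(1) by auto
qed

section \<open>Blocks of seven cells with nearly straight sides\<close>

lemma row_cells: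
  assumes "1 \<le> j" "Q \<in> nodes j" "corner_frame Q p d b"
  defines "n \<equiv> subdiv (Suc j)" defines "c \<equiv> snd Q / real n"
  obtains C where "\<And>i. i < n \<Longrightarrow> C i \<in> squares \<delta> h (Suc j)" "\<And>i. i < n \<Longrightarrow> snd (C i) = c"
    "\<And>i. i < n \<Longrightarrow> corner_frame (C i) (p + (real i * c) *\<^sub>R d) d b"
proof -
  have "\<exists>Q'. Q' \<in> squares \<delta> h (Suc j) \<and> snd Q' = c \<and> corner_frame Q' (p + (real i * c) *\<^sub>R d) d b" if "i < n" for i
    using corner_frame_cell[OF assms(3) that] nodes_cell(1)[OF assms(1,2)] unfolding n_def c_def by metis
  then obtain C where "\<And>i. i < n \<Longrightarrow> C i \<in> squares \<delta> h (Suc j) \<and> snd (C i) = c \<and> corner_frame (C i) (p + (real i * c) *\<^sub>R d) d b"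
    by metis
  then show thesis
    by (intro that[of C]) auto
qed

lemma opposite_side:
  assumes "corner_frame Q p d b"
  shows "corner_frame Q (p + snd Q *\<^sub>R b) d (- b)"
  by (rule corner_frame_swap[OF corner_frame_flip[OF corner_frame_swap[OF assms]]])

text \<open>
  The line at distance \<open>c\<close> from the edge consists of the far edges of the cells in the row. It is
  therefore subject to the same bound as the edge itself.
\<close>

lemma row_lines_lipschitz:
  assumes "1 \<le> j" "Q \<in> nodes j" "corner_frame Q p d b"
  defines "n \<equiv> subdiv (Suc j)" defines "c \<equiv> snd Q / real n"
  assumes a: "a \<in> {p, p + c *\<^sub>R b}" and st: "0 \<le> s" "s \<le> t" "t \<le> snd Q"
  shows "norm (\<phi> (a + t *\<^sub>R d) - \<phi> (a + s *\<^sub>R d)) \<le> M * (t - s)"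
proof -
  have n: "7 \<le> n"
    using subdiv assms(1) by (simp add: n_def)
  have Q: "0 < snd Q" "snd Q = real n * c" "0 < c"
    using nodes_pos_subset(1)[OF assms(2)] n by (auto simp: c_def)
  obtain C where C: "\<And>i. i < n \<Longrightarrow> C i \<in> squares \<delta> h (Suc j)" "\<And>i. i < n \<Longrightarrow> snd (C i) = c"
    "\<And>i. i < n \<Longrightarrow> corner_frame (C i) (p + (real i * c) *\<^sub>R d) d b"
    using row_cells[OF assms(1-3)] unfolding n_def c_def by metis
  have lip: "norm (\<phi> (a + t *\<^sub>R d) - \<phi> (a + s *\<^sub>R d)) \<le> M * (t - s)"
    if i: "i < n" "real i * c \<le> s" "s \<le> t" "t \<le> real (Suc i) * c" for i s t
  proof -
    have node: "C i \<in> nodes (Suc j)" "1 \<le> Suc j"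
      using C(1)[OF i(1)] by (auto simp: nodes_def)
    obtain b' where cf: "corner_frame (C i) (a + (real i * c) *\<^sub>R d) d b'"
      using a C(3)[OF i(1)] opposite_side[OF C(3)[OF i(1)]] C(2)[OF i(1)] by (auto simp: algebra_simps)
    have "dist (\<phi> (a + (real i * c) *\<^sub>R d + (t - real i * c) *\<^sub>R d)) (\<phi> (a + (real i * c) *\<^sub>R d + (s - real i * c) *\<^sub>R d))
        \<le> M * dist (t - real i * c) (s - real i * c)"
      by (rule lipschitz_onD[OF edge_lipschitz[OF node(2,1) cf]]) (use i C(2)[OF i(1)] in \<open>auto simp: algebra_simps\<close>)
    then show ?thesis
      using i(3) by (simp add: dist_norm scaleR_left_diff_distrib)
  qed
  have "norm (\<phi> (a + t *\<^sub>R d) - \<phi> (a + s *\<^sub>R d)) \<le> M * (t - s) + 2 * 0"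
  proof (rule grid_almost_lipschitz[where g = "\<lambda>s. \<phi> (a + s *\<^sub>R d)" and n = n and c = c])
    show "norm (\<phi> (a + (real (Suc i) * c) *\<^sub>R d) - \<phi> (a + (real i * c) *\<^sub>R d)) \<le> M * c" if "i < n" for i
    proof -
      have "real i * c \<le> real (Suc i) * c" "real (Suc i) * c - real i * c = c"
        using Q(3) by (auto simp: algebra_simps)
      then show ?thesis
        using lip[OF that order.refl _ order.refl] by simp
    qed
  qed (use lip Q n st in auto)
  then show ?thesis by simp
qed

lemma direction_orthonormal:
  assumes "v \<noteq> (0 :: real^2)"
  obtains u w where "orthonormal u w" "v \<bullet> u = norm v"
proof
  let ?u = "v /\<^sub>R norm v"
  have "norm ?u = 1"
    using assms by simp
  then show "orthonormal ?u (vector [- ?u $ 2, ?u $ 1])"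
    by (simp only: orthonormal_def norm_eq_1) (simp add: inner_2)
  show "v \<bullet> ?u = norm v"
    using assms by (simp add: dot_square_norm power2_eq_square)
qed

text \<open>
  An averaging argument. Let \<open>u\<close> be the direction of the displacement along the long edge. The displacements
  in the direction \<open>u\<close> of the \<open>m\<close> blocks of seven cells sum to more than \<open>r\<close> times the length of the edge,
  and on the opposite side of the row to at most \<open>2 M c\<close> less. Some block does at least as well as the average of
  both sums together. As neither side of a block can exceed \<open>7 M c\<close>, each of its sides is nearly extremal.
\<close>

lemma two_straight_lines:
  assumes "1 \<le> j" "Q \<in> nodes j" "corner_frame Q p d b"
    and long: "r * snd Q < norm (\<phi> (p + snd Q *\<^sub>R d) - \<phi> p)" and "0 \<le> r"
    and m: "subdiv (Suc j) = 7 * m"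
  defines "c \<equiv> snd Q / real (subdiv (Suc j))"
  obtains u w k where "orthonormal u w" "k < m"
    "\<forall>a \<in> {p, p + c *\<^sub>R b}.
      (\<phi> (a + (real (7 * Suc k) * c) *\<^sub>R d) - \<phi> (a + (real (7 * k) * c) *\<^sub>R d)) \<bullet> u \<ge>
        M * (7 * c) - (14 * (M - r) + 2 * M / real m) * c"
proof -
  define n where "n = subdiv (Suc j)"
  have n: "7 \<le> n" "real n = 7 * real m" "0 < m"
    using subdiv[of "Suc j"] assms(1) m by (auto simp: n_def)
  have Q: "0 < snd Q" "snd Q = real n * c" "0 < c"
    using nodes_pos_subset(1)[OF assms(2)] n(1) by (auto simp: c_def n_def)
  note lip = row_lines_lipschitz[OF assms(1-3), folded c_def]
  define v where "v = \<phi> (p + snd Q *\<^sub>R d) - \<phi> p"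
  have v: "r * snd Q < norm v"
    using long by (simp add: v_def)
  moreover have "0 \<le> r * snd Q"
    using assms(5) Q(1) by simp
  ultimately have "v \<noteq> 0"
    by auto
  obtain u w where uw: "orthonormal u w" "v \<bullet> u = norm v"
    using direction_orthonormal[OF \<open>v \<noteq> 0\<close>] .
  have cs: "x \<bullet> u \<le> norm x" for x
    using norm_cauchy_schwarz[of x u] uw(1) by (simp add: orthonormal_def)
  define A where "A = (\<lambda>a k. (\<phi> (a + (real (7 * Suc k) * c) *\<^sub>R d) - \<phi> (a + (real (7 * k) * c) *\<^sub>R d)) \<bullet> u)"
  have total: "(\<Sum>k<m. A a k) = (\<phi> (a + snd Q *\<^sub>R d) - \<phi> a) \<bullet> u" for a
  proof -
    have "(\<Sum>k<m. A a k) = (\<Sum>k<m. \<phi> (a + (real (7 * Suc k) * c) *\<^sub>R d) \<bullet> u - \<phi> (a + (real (7 * k) * c) *\<^sub>R d) \<bullet> u)"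
      by (simp add: A_def inner_diff_left)
    also have "\<dots> = \<phi> (a + (real (7 * m) * c) *\<^sub>R d) \<bullet> u - \<phi> (a + (real (7 * 0) * c) *\<^sub>R d) \<bullet> u"
      by (rule sum_lessThan_telescope)
    finally show ?thesis
      using Q(2) n(2) by (simp add: inner_diff_left)
  qed
  let ?p = "p + c *\<^sub>R b"
  have le: "A a k \<le> M * (7 * c)" if "a \<in> {p, ?p}" "k < m" for a k
  proof -
    have "real (7 * Suc k) \<le> real n"
      using that(2) n(2) by simp
    then have "real (7 * Suc k) * c \<le> snd Q"
      unfolding Q(2) using Q(3) by (intro mult_right_mono) auto
    then have "norm (\<phi> (a + (real (7 * Suc k) * c) *\<^sub>R d) - \<phi> (a + (real (7 * k) * c) *\<^sub>R d)) \<le> M * (real (7 * Suc k) * c - real (7 * k) * c)"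
      using Q(3) by (intro lip that(1)) auto
    also have "real (7 * Suc k) * c - real (7 * k) * c = 7 * c"
      by (simp add: algebra_simps)
    finally show ?thesis
      using cs order.trans unfolding A_def by blast
  qed
  have cQ: "c \<le> snd Q"
    using mult_right_mono[of 1 "real n" c] Q(2,3) n(1) by simp
  have "norm (\<phi> ?p - \<phi> p) \<le> M * c"
    using edge_le[OF assms(1,2) corner_frame_swap[OF assms(3)], of c] Q(3) cQ by simp
  moreover have "norm (\<phi> (p + snd Q *\<^sub>R d + c *\<^sub>R b) - \<phi> (p + snd Q *\<^sub>R d)) \<le> M * c"
    using edge_le[OF assms(1,2) corner_frame_swap[OF corner_frame_flip[OF assms(3)]], of c] Q(3) cQ by simp
  ultimately have "(\<phi> ?p - \<phi> p) \<bullet> u \<le> M * c" "(\<phi> (p + snd Q *\<^sub>R d) - \<phi> (p + snd Q *\<^sub>R d + c *\<^sub>R b)) \<bullet> u \<le> M * c"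
    using cs[of "\<phi> ?p - \<phi> p"] cs[of "\<phi> (p + snd Q *\<^sub>R d) - \<phi> (p + snd Q *\<^sub>R d + c *\<^sub>R b)"]
    by (auto simp: norm_minus_commute)
  moreover have eq: "?p + snd Q *\<^sub>R d = p + snd Q *\<^sub>R d + c *\<^sub>R b"
    by (simp add: algebra_simps)
  ultimately have "(\<phi> (?p + snd Q *\<^sub>R d) - \<phi> ?p) \<bullet> u \<ge> v \<bullet> u - 2 * (M * c)"
    unfolding eq by (simp add: v_def inner_diff_left)
  then have sum: "(\<Sum>k<m. A p k + A ?p k) > 2 * (r * snd Q) - 2 * (M * c)"
    using total[of p] total[of ?p] uw(2) v by (simp add: sum.distrib v_def)
  define X where "X = 14 * r * c - 2 * M / real m * c"
  have "\<exists>k<m. A p k + A ?p k \<ge> X"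
  proof (rule ccontr)
    assume "\<not> ?thesis"
    then have "(\<Sum>k<m. A p k + A ?p k) \<le> real (card {..<m}) * X"
      by (intro sum_bounded_above) force
    also have "\<dots> = 2 * (r * snd Q) - 2 * (M * c)"
      using n(2,3) Q(2) by (simp add: X_def field_simps)
    finally show False
      using sum by simp
  qed
  then obtain k where k: "k < m" "A p k + A ?p k \<ge> X" by blast
  have "A a k \<ge> M * (7 * c) - (14 * (M - r) + 2 * M / real m) * c" if "a \<in> {p, ?p}" for a
    using that k(2) le[of p k] le[of ?p k] k(1) by (auto simp: X_def algebra_simps)
  then show thesis
    using that[OF uw(1) k(1)] by (simp add: A_def)
qed

end

section \<open>Areas of images of squares\<close>

text \<open>
  A frame of \<open>n\<close> cells per side has at most \<open>4 n\<close> cells, whose areas are smaller by the factor \<open>n\<^sup>2\<close>. Used with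
  the identity and with \<open>\<phi>\<close>: frames are negligible for large \<open>n\<close>, and so are their images.
\<close>

lemma measure_image_frame_le:
  assumes "1 \<le> n" "0 < snd Q" "0 \<le> K"
    and "\<And>Q'. Q' \<in> frame n Q \<Longrightarrow> compact (f ` region Q')"
    and "\<And>Q'. Q' \<in> frame n Q \<Longrightarrow> measure lebesgue (f ` region Q') \<le> K * (snd Q')\<^sup>2"
  shows "compact (f ` frame_region n Q)"
    and "measure lebesgue (f ` frame_region n Q) \<le> 4 * K * (snd Q)\<^sup>2 / real n"
proof -
  have eq: "f ` frame_region n Q = (\<Union>Q' \<in> frame n Q. f ` region Q')"
    by (auto simp: frame_region_def)
  note fin = frame_bounded_by_4n[OF assms(1), of Q]
  show "compact (f ` frame_region n Q)"
    unfolding eq by (intro compact_UN fin assms)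
  have "measure lebesgue (f ` frame_region n Q) \<le> (\<Sum>Q' \<in> frame n Q. measure lebesgue (f ` region Q'))"
    unfolding eq by (intro measure_UNION_le fin fmeasurableD lmeasurable_compact assms)
  also have "\<dots> \<le> (\<Sum>Q' \<in> frame n Q. K * (snd Q / real n)\<^sup>2)"
  proof (intro sum_mono)
    fix Q' assume "Q' \<in> frame n Q"
    moreover from this have "snd Q' = snd Q / real n"
      by (rule frame_cases)
    ultimately show "measure lebesgue (f ` region Q') \<le> K * (snd Q / real n)\<^sup>2"
      using assms(5) by metis
  qed
  also have "\<dots> = real (card (frame n Q)) * (K * (snd Q / real n)\<^sup>2)"
    by simp
  also have "\<dots> \<le> real (4 * n) * (K * (snd Q / real n)\<^sup>2)"
    using fin(2) assms(3) by (intro mult_right_mono) auto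
  also have "\<dots> = 4 * K * (snd Q)\<^sup>2 / real n"
    using assms(1) by (simp add: power2_eq_square field_simps)
  finally show "measure lebesgue (f ` frame_region n Q) \<le> 4 * K * (snd Q)\<^sup>2 / real n" .
qed

context mcmullen_map
begin

lemma negligible_image:
  assumes "negligible Z" "Z \<subseteq> unit_square"
  shows "negligible (\<phi> ` Z)"
proof (rule negligible_locally_Lipschitz_image)
  fix x assume "x \<in> Z"
  then show "\<exists>T B. open T \<and> x \<in> T \<and> (\<forall>y\<in>Z \<inter> T. norm (\<phi> y - \<phi> x) \<le> B * norm (y - x))"
    using lipschitz_norm assms(2) by (intro exI[of _ UNIV] exI[of _ L]) auto
qed (use assms in auto)

lemma continuous: "continuous_on unit_square \<phi>"
  by (rule lipschitz_on_continuous_on[OF lipschitz])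

lemma compact_image: "compact K \<Longrightarrow> K \<subseteq> unit_square \<Longrightarrow> compact (\<phi> ` K)"
  by (intro compact_continuous_image continuous_on_subset[OF continuous])

text \<open>
  The image lies in the square of side \<open>4 L\<close> times that of \<open>Q\<close> that is centred at the image of a corner.
\<close>

lemma measure_image_square_le:
  assumes "region Q \<subseteq> unit_square" "0 < snd Q"
  shows "measure lebesgue (\<phi> ` region Q) \<le> 16 * L\<^sup>2 * (snd Q)\<^sup>2"
proof -
  let ?P = "(\<phi> (fst Q) - vec (2 * L * snd Q), 4 * L * snd Q)"
  have "\<phi> ` region Q \<subseteq> region ?P"
  proof
    fix z assume "z \<in> \<phi> ` region Q"
    then obtain x where x: "x \<in> region Q" "z = \<phi> x" by blast
    have c: "fst Q \<in> region Q"
      using assms(2) by (simp add: region_mem)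
    have "norm (x - fst Q) \<le> \<bar>x $ 1 - fst Q $ 1\<bar> + \<bar>x $ 2 - fst Q $ 2\<bar>"
      using norm_le_l1_cart[of "x - fst Q"] by (simp add: sum_2)
    also have "\<dots> \<le> 2 * snd Q"
      using x(1) by (simp add: region_mem)
    finally have "L * norm (x - fst Q) \<le> L * (2 * snd Q)"
      using L_pos by (intro mult_left_mono) auto
    then have "norm (z - \<phi> (fst Q)) \<le> L * (2 * snd Q)"
      using lipschitz_norm[of x "fst Q"] x c assms(1) by force
    then have "\<bar>z $ i - \<phi> (fst Q) $ i\<bar> \<le> 2 * L * snd Q" for i
      using component_le_norm_cart[of "z - \<phi> (fst Q)" i] by simp
    from this[of 1] this[of 2] show "z \<in> region ?P"
      by (simp add: region_mem abs_le_iff)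
  qed
  then have "measure lebesgue (\<phi> ` region Q) \<le> measure lebesgue (region ?P)"
    using compact_image[OF compact_region assms(1)] compact_region
    by (intro measure_mono_fmeasurable fmeasurableD lmeasurable_compact) auto
  also have "\<dots> = 16 * L\<^sup>2 * (snd Q)\<^sup>2"
    using assms(2) L_pos by (subst measure_region) (auto simp: power2_eq_square)
  finally show ?thesis .
qed

lemma frame_measures:
  assumes "1 \<le> j" "Q \<in> nodes j"
  defines "n \<equiv> subdiv (Suc j)"
  shows "compact (frame_region n Q)" "measure lebesgue (frame_region n Q) \<le> 4 * (snd Q)\<^sup>2 / real n"
    and "compact (\<phi> ` frame_region n Q)" "measure lebesgue (\<phi> ` frame_region n Q) \<le> 64 * L\<^sup>2 * (snd Q)\<^sup>2 / real n"
proof -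
  have n: "1 \<le> n"
    using subdiv(3)[of "Suc j"] assms(1) by (simp add: n_def)
  have Q: "0 < snd Q" "region Q \<subseteq> unit_square"
    using nodes_pos_subset[OF assms(2)] by auto
  have cell: "region Q' \<subseteq> unit_square" "0 < snd Q'" if "Q' \<in> frame n Q" for Q'
    using frame_cell_subset[OF that Q(1)] Q(2) by auto
  have "compact ((\<lambda>x. x) ` region Q') \<and> measure lebesgue ((\<lambda>x. x) ` region Q') \<le> 1 * (snd Q')\<^sup>2" if "Q' \<in> frame n Q" for Q'
    using measure_region[of Q'] cell(2)[OF that] compact_region by simp
  then show "compact (frame_region n Q)" "measure lebesgue (frame_region n Q) \<le> 4 * (snd Q)\<^sup>2 / real n"
    using measure_image_frame_le[OF n Q(1), of 1 "\<lambda>x. x"] by auto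
  have "compact (\<phi> ` region Q') \<and> measure lebesgue (\<phi> ` region Q') \<le> 16 * L\<^sup>2 * (snd Q')\<^sup>2" if "Q' \<in> frame n Q" for Q'
    using measure_image_square_le cell[OF that] compact_image[OF compact_region] by blast
  then show "compact (\<phi> ` frame_region n Q)" "measure lebesgue (\<phi> ` frame_region n Q) \<le> 64 * L\<^sup>2 * (snd Q)\<^sup>2 / real n"
    using measure_image_frame_le[OF n Q(1), of "16 * L\<^sup>2" \<phi>] by auto
qed

end

locale mcmullen_jacobian = mcmullen_map +
  fixes t1 s1 :: real
  assumes jacobian: "AE x in lebesgue_on unit_square. has_Jac \<phi> unit_square x (mcmullen_density \<delta> \<gamma> h t1 s1 x)"
begin

lemma jacobian_exceptional_set:
  obtains N where "negligible N"
    "\<And>x. x \<in> unit_square \<Longrightarrow> x \<notin> N \<Longrightarrow> has_Jac \<phi> unit_square x (mcmullen_density \<delta> \<gamma> h t1 s1 x)"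
proof -
  have "unit_square \<in> sets lebesgue"
    by (simp add: region_def)
  then have "AE x in lebesgue. x \<in> unit_square \<longrightarrow> has_Jac \<phi> unit_square x (mcmullen_density \<delta> \<gamma> h t1 s1 x)"
    using jacobian AE_restrict_space_iff[of unit_square lebesgue] by simp
  then obtain N where "N \<in> null_sets lebesgue"
    "{x \<in> space lebesgue. \<not> (x \<in> unit_square \<longrightarrow> has_Jac \<phi> unit_square x (mcmullen_density \<delta> \<gamma> h t1 s1 x))} \<subseteq> N"
    by (auto simp: eventually_ae_filter)
  then show thesis
    by (intro that[of N]) (auto simp: negligible_iff_null_sets)
qed

text \<open>
  The change of variables formula on the part of \<open>E\<close> where \<open>\<phi>\<close> is differentiable; the remainder is null, and so is
  its image under the Lipschitz map \<open>\<phi>\<close>.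
\<close>

lemma measure_image_constant_density:
  assumes E: "E \<in> lmeasurable" "E \<subseteq> unit_square" and c: "0 \<le> c"
    and density: "\<And>x. x \<in> E \<Longrightarrow> mcmullen_density \<delta> \<gamma> h t1 s1 x = c"
  shows "\<phi> ` E \<in> lmeasurable" "measure lebesgue (\<phi> ` E) = c * measure lebesgue E"
proof -
  obtain N where N: "negligible N"
    "\<And>x. x \<in> unit_square \<Longrightarrow> x \<notin> N \<Longrightarrow> has_Jac \<phi> unit_square x (mcmullen_density \<delta> \<gamma> h t1 s1 x)"
    using jacobian_exceptional_set by blast
  define E' where "E' = E - N"
  have "\<forall>x\<in>E'. \<exists>D. (\<phi> has_derivative D) (at x within unit_square) \<and> det (matrix D) = c"
    using N(2) E(2) density unfolding E'_def has_Jac_def by fastforce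
  then obtain D where D: "\<And>x. x \<in> E' \<Longrightarrow> (\<phi> has_derivative D x) (at x within unit_square)"
    "\<And>x. x \<in> E' \<Longrightarrow> det (matrix (D x)) = c"
    by metis
  have sub: "E' \<subseteq> unit_square"
    using E(2) by (auto simp: E'_def)
  have sd: "negligible (sym_diff E E')"
    by (rule negligible_subset[OF N(1)]) (auto simp: E'_def)
  then have E': "E' \<in> lmeasurable" "measure lebesgue E' = measure lebesgue E"
    using lmeasurable_negligible_symdiff[OF E(1)] measure_negligible_symdiff[of E E'] E(1) by auto
  have der: "(\<phi> has_derivative D x) (at x within E')" if "x \<in> E'" for x
    using D(1)[OF that] sub by (rule has_derivative_subset)
  have inj: "inj_on \<phi> E'"
    using injective sub by (rule inj_on_subset)
  have int: "((\<lambda>x. \<bar>det (matrix (D x))\<bar>) has_integral c * measure lebesgue E') E'"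
  proof (rule has_integral_eq)
    show "((\<lambda>x. c * 1) has_integral c * measure lebesgue E') E'"
      by (intro has_integral_mult_right) (use E'(1) in \<open>simp add: lmeasure_integral integrable_integral integrable_on_const\<close>)
  qed (use D(2) c in auto)
  have image: "\<phi> ` E' \<in> lmeasurable" "measure lebesgue (\<phi> ` E') = c * measure lebesgue E'"
    using measurable_differentiable_image_eq[OF fmeasurableD[OF E'(1)] der inj]
      measure_differentiable_image_eq[OF fmeasurableD[OF E'(1)] der inj has_integral_integrable[OF int]]
      has_integral_integrable[OF int] integral_unique[OF int] by simp_all
  have "negligible (\<phi> ` (E \<inter> N))"
    using E(2) by (intro negligible_image negligible_subset[OF N(1)]) auto
  then have sd2: "negligible (sym_diff (\<phi> ` E') (\<phi> ` E))"
    by (rule negligible_subset) (auto simp: E'_def)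
  then show "\<phi> ` E \<in> lmeasurable"
    by (rule lmeasurable_negligible_symdiff[OF image(1)])
  show "measure lebesgue (\<phi> ` E) = c * measure lebesgue E"
    using measure_negligible_symdiff[OF _ sd2] image E'(2) by (simp add: fmeasurableD)
qed

lemma frame_area_bounds:
  assumes "2 \<le> j"
  shows "0 \<le> frame_area h j" "frame_area h j < \<gamma>"
proof -
  show "frame_area h j < \<gamma>"
    using admissible assms by (auto simp: admissible_def frame_area_def)
  have "1 \<le> ratio h j"
    using subdiv[OF assms] by simp
  then show "0 \<le> frame_area h j"
    by (simp add: frame_area_def)
qed

lemma delta_sq_less: "\<delta>\<^sup>2 < 14 * \<delta>"
  using mult_strict_right_mono[of \<delta> 14 \<delta>] \<delta>_pos \<delta>_less by (simp add: power2_eq_square)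

lemma constants_nonneg:
  assumes "2 \<le> j"
  shows "0 \<le> t_const \<delta> \<gamma> h j" "0 \<le> s_const \<delta> \<gamma> h j"
proof -
  note f = frame_area_bounds[OF assms]
  have "\<delta>\<^sup>2 * frame_area h j \<le> \<delta>\<^sup>2 * 1"
    using f \<gamma>_less \<delta>_pos by (intro mult_left_mono) auto
  then have "\<delta>\<^sup>2 * frame_area h j \<le> 1 - \<gamma>"
    using \<gamma>_less delta_sq_less by linarith
  then show "0 \<le> t_const \<delta> \<gamma> h j"
    unfolding t_const_def using f \<gamma>_less \<delta>_pos delta_sq_less by (intro divide_nonneg_nonneg mult_nonneg_nonneg) auto
  show "0 \<le> s_const \<delta> \<gamma> h j"
    unfolding s_const_def using f \<gamma>_less \<delta>_pos delta_sq_less by (intro divide_nonneg_nonneg) auto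
qed

text \<open>
  \<open>T'\<close> and \<open>S' - T'\<close> without the frames of the next stage carry the constant densities \<open>t\<close> and \<open>s\<close>. The images
  of the frames themselves are estimated by the Lipschitz constant of \<open>\<phi>\<close>.
\<close>

lemma square_areas:
  assumes "1 \<le> j" "Q \<in> squares \<delta> h j"
  defines "n \<equiv> subdiv (Suc j)" and "t \<equiv> t_const \<delta> \<gamma> h (Suc j)" and "s \<equiv> s_const \<delta> \<gamma> h (Suc j)"
  shows "measure lebesgue (\<phi> ` region Q) \<le> (t * \<delta>\<^sup>2 + s * (1 - \<delta>\<^sup>2) + 128 * L\<^sup>2 / real n) * (snd Q)\<^sup>2"
    and "t * \<delta>\<^sup>2 * (1 - 4 / real n) * (snd Q)\<^sup>2 \<le> measure lebesgue (\<phi> ` region (concentric \<delta> Q))"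
proof -
  let ?T = "concentric \<delta> Q"
  have ts: "0 \<le> t" "0 \<le> s"
    using constants_nonneg[of "Suc j"] assms(1) by (auto simp: t_def s_def)
  have Q: "0 < snd Q" "region Q \<subseteq> unit_square" "Q \<in> nodes j" "?T \<in> nodes j"
    using squares_pos_subset[OF assms(2)] assms(2) by (auto simp: nodes_def)
  have T: "0 < snd ?T" "region ?T \<subseteq> region Q" "snd ?T = \<delta> * snd Q"
    using concentric_in_square[OF Q(1)] by (auto simp: concentric_def)
  note FQ = frame_measures[OF assms(1) Q(3), folded n_def] and FT = frame_measures[OF assms(1) Q(4), folded n_def]
  define FU where "FU = frame_region n Q \<union> frame_region n ?T"
  define ET ES where "ET = region ?T - frame_region n ?T" and "ES = region Q - region ?T - FU"
  have meas: "region Q \<in> lmeasurable" "region ?T \<in> lmeasurable" "frame_region n Q \<in> lmeasurable" "frame_region n ?T \<in> lmeasurable"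
    using FQ(1) FT(1) compact_region[of Q] compact_region[of ?T] by (simp_all add: lmeasurable_compact)
  then have measE: "ET \<in> lmeasurable" "ES \<in> lmeasurable"
    unfolding ET_def ES_def FU_def by (auto intro!: fmeasurable.Diff fmeasurable.Un)
  have QS: "x \<in> S_union \<delta> h j" if "x \<in> region Q" for x
    using that assms(2) by (auto simp: S_union_def)
  have dT: "mcmullen_density \<delta> \<gamma> h t1 s1 x = t" if "x \<in> ET" for x
  proof -
    have x: "x \<in> region ?T" "x \<in> region Q" "x \<notin> S_union \<delta> h (Suc j)"
      using that T(2) square_Int_S_union(2)[OF assms(1,2)] by (auto simp: ET_def n_def)
    then show ?thesis
      using density_between_stages[OF assms(1) QS[OF x(2)] x(3)] square_minus_S_union(2)[OF assms(1,2) x(2,3)]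
      by (simp add: t_def)
  qed
  have dS: "mcmullen_density \<delta> \<gamma> h t1 s1 x = s" if "x \<in> ES" for x
  proof -
    have x: "x \<notin> region ?T" "x \<in> region Q" "x \<notin> S_union \<delta> h (Suc j)"
      using that square_Int_S_union(1)[OF assms(1,2)] by (auto simp: ES_def FU_def n_def)
    then show ?thesis
      using density_between_stages[OF assms(1) QS[OF x(2)] x(3)] square_minus_S_union(2)[OF assms(1,2) x(2,3)]
      by (simp add: s_def)
  qed
  have sub: "ET \<subseteq> unit_square" "ES \<subseteq> unit_square"
    using Q(2) T(2) by (auto simp: ET_def ES_def)
  have iT: "\<phi> ` ET \<in> lmeasurable" "measure lebesgue (\<phi> ` ET) = t * measure lebesgue ET"
    by (rule measure_image_constant_density[OF measE(1) sub(1) ts(1)], erule dT)+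
  have iS: "\<phi> ` ES \<in> lmeasurable" "measure lebesgue (\<phi> ` ES) = s * measure lebesgue ES"
    by (rule measure_image_constant_density[OF measE(2) sub(2) ts(2)], erule dS)+
  have mQ: "measure lebesgue (region Q) = (snd Q)\<^sup>2" and mT: "measure lebesgue (region ?T) = \<delta>\<^sup>2 * (snd Q)\<^sup>2"
    using measure_region[of Q] measure_region[of ?T] Q(1) T(1,3) by (auto simp: power_mult_distrib)
  have "measure lebesgue ET \<le> \<delta>\<^sup>2 * (snd Q)\<^sup>2"
    unfolding mT[symmetric] using meas measE by (intro measure_mono_fmeasurable fmeasurableD) (auto simp: ET_def)
  then have uT: "t * measure lebesgue ET \<le> t * (\<delta>\<^sup>2 * (snd Q)\<^sup>2)"
    using ts by (intro mult_left_mono)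
  have "measure lebesgue ES \<le> measure lebesgue (region Q - region ?T)"
    using meas measE by (intro measure_mono_fmeasurable fmeasurableD fmeasurable.Diff) (auto simp: ES_def)
  also have "\<dots> = (snd Q)\<^sup>2 - \<delta>\<^sup>2 * (snd Q)\<^sup>2"
    using measurable_measure_Diff[OF meas(1) _ T(2)] meas(2) mQ mT by (simp add: fmeasurableD)
  finally have uS: "s * measure lebesgue ES \<le> s * ((snd Q)\<^sup>2 - \<delta>\<^sup>2 * (snd Q)\<^sup>2)"
    using ts by (intro mult_left_mono)
  have "\<delta>\<^sup>2 \<le> 1"
    using \<delta>_pos \<delta>_less by (simp add: power_le_one)
  then have "(snd ?T)\<^sup>2 \<le> (snd Q)\<^sup>2"
    by (simp add: T(3) power_mult_distrib mult_left_le_one_le)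
  then have "64 * L\<^sup>2 * (snd ?T)\<^sup>2 / real n \<le> 64 * L\<^sup>2 * (snd Q)\<^sup>2 / real n"
    by (intro divide_right_mono mult_left_mono) auto
  then have uF: "measure lebesgue (\<phi> ` frame_region n ?T) \<le> 64 * L\<^sup>2 * (snd Q)\<^sup>2 / real n"
    using FT(4) by linarith
  have iF: "\<phi> ` frame_region n Q \<in> sets lebesgue" "\<phi> ` frame_region n ?T \<in> sets lebesgue"
    using FQ(3) FT(3) by (auto intro: fmeasurableD lmeasurable_compact)
  have "region Q \<subseteq> ET \<union> ES \<union> frame_region n Q \<union> frame_region n ?T"
    by (auto simp: ET_def ES_def FU_def)
  then have "\<phi> ` region Q \<subseteq> \<phi> ` ET \<union> \<phi> ` ES \<union> \<phi> ` frame_region n Q \<union> \<phi> ` frame_region n ?T"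
    by blast
  then have "measure lebesgue (\<phi> ` region Q) \<le> measure lebesgue (\<phi> ` ET \<union> \<phi> ` ES \<union> \<phi> ` frame_region n Q \<union> \<phi> ` frame_region n ?T)"
    using compact_image[OF compact_region Q(2)] iT(1) iS(1) FQ(3) FT(3)
    by (intro measure_mono_fmeasurable fmeasurable.Un fmeasurableD) (auto intro: lmeasurable_compact)
  also have "\<dots> \<le> measure lebesgue (\<phi> ` ET) + measure lebesgue (\<phi> ` ES) + measure lebesgue (\<phi> ` frame_region n Q) + measure lebesgue (\<phi> ` frame_region n ?T)"
    using iT(1) iS(1) iF by (intro order.trans[OF measure_Un_le] add_mono order.refl sets.Un) (auto simp: fmeasurableD)
  also have "\<dots> \<le> t * (\<delta>\<^sup>2 * (snd Q)\<^sup>2) + s * ((snd Q)\<^sup>2 - \<delta>\<^sup>2 * (snd Q)\<^sup>2) + 64 * L\<^sup>2 * (snd Q)\<^sup>2 / real n + 64 * L\<^sup>2 * (snd Q)\<^sup>2 / real n"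
    using uT uS uF FQ(4) iT(2) iS(2) by (intro add_mono) auto
  also have "\<dots> = (t * \<delta>\<^sup>2 + s * (1 - \<delta>\<^sup>2) + 128 * L\<^sup>2 / real n) * (snd Q)\<^sup>2"
    by (simp add: algebra_simps)
  finally show "measure lebesgue (\<phi> ` region Q) \<le> (t * \<delta>\<^sup>2 + s * (1 - \<delta>\<^sup>2) + 128 * L\<^sup>2 / real n) * (snd Q)\<^sup>2" .
  have "measure lebesgue ET = \<delta>\<^sup>2 * (snd Q)\<^sup>2 - measure lebesgue (frame_region n ?T)"
    unfolding ET_def using measurable_measure_Diff[OF meas(2) _ frame_region_subset[OF T(1)]] meas(4) mT
    by (simp add: fmeasurableD)
  also have "\<dots> \<ge> \<delta>\<^sup>2 * (snd Q)\<^sup>2 - 4 * (\<delta> * snd Q)\<^sup>2 / real n"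
    using FT(2) T(3) by simp
  finally have "t * (\<delta>\<^sup>2 * (snd Q)\<^sup>2 - 4 * (\<delta> * snd Q)\<^sup>2 / real n) \<le> measure lebesgue (\<phi> ` ET)"
    unfolding iT(2) using ts by (intro mult_left_mono)
  also have "\<dots> \<le> measure lebesgue (\<phi> ` region ?T)"
    using compact_image[OF compact_region, of ?T] T(2) Q(2)
    by (intro measure_mono_fmeasurable fmeasurableD[OF iT(1)] lmeasurable_compact) (auto simp: ET_def)
  finally show "t * \<delta>\<^sup>2 * (1 - 4 / real n) * (snd Q)\<^sup>2 \<le> measure lebesgue (\<phi> ` region ?T)"
    by (simp add: algebra_simps power_mult_distrib)
qed

text \<open>
  In the limit \<open>t \<delta>\<^sup>2\<close> tends to \<open>1 - \<gamma>\<close> and \<open>s (1 - \<delta>\<^sup>2)\<close> to \<open>\<gamma>\<close>. The bounds leave room on both sides: \<open>8 / 7 > 1\<close>, which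
  gives area at most \<open>8 c\<^sup>2\<close> to the image of seven cells, and \<open>14 \<delta> < 1 - \<gamma>\<close>.
\<close>

lemma eventually_square_areas:
  "\<forall>\<^sub>F j in sequentially. \<forall>Q \<in> squares \<delta> h j.
    measure lebesgue (\<phi> ` region Q) \<le> 8 / 7 * (snd Q)\<^sup>2 \<and>
    14 * \<delta> * (snd Q)\<^sup>2 \<le> measure lebesgue (\<phi> ` region (concentric \<delta> Q))"
proof -
  have "filterlim (ratio h) at_top sequentially"
    using admissible by (simp add: admissible_def)
  then have "filterlim (\<lambda>j. ratio h (Suc j)) at_top sequentially"
    by (rule filterlim_compose[OF _ filterlim_Suc])
  then have r: "(\<lambda>j. inverse (ratio h (Suc j))) \<longlonglongrightarrow> 0"
    by (rule tendsto_inverse_0_at_top)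
  have "frame_area h j = 4 * inverse (ratio h j) - 4 * (inverse (ratio h j))\<^sup>2" for j
    by (cases "ratio h j = 0") (simp_all add: frame_area_def diff_divide_distrib power2_eq_square divide_inverse algebra_simps)
  then have \<sigma>: "(\<lambda>j. frame_area h (Suc j)) \<longlonglongrightarrow> 0"
    using tendsto_diff[OF tendsto_mult_left[OF r, of 4] tendsto_mult_left[OF tendsto_power[OF r, of 2], of 4]] by simp
  have "filterlim (\<lambda>j. real (subdiv (Suc j))) at_top sequentially"
    using filterlim_compose[OF subdiv_at_top filterlim_Suc] .
  then have n: "(\<lambda>j. inverse (real (subdiv (Suc j)))) \<longlonglongrightarrow> 0"
    by (rule tendsto_inverse_0_at_top)
  have d: "\<delta>\<^sup>2 \<noteq> 0" "1 - \<delta>\<^sup>2 \<noteq> 0"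
    using \<delta>_pos \<gamma>_pos \<gamma>_less delta_sq_less by auto
  have t: "(\<lambda>j. t_const \<delta> \<gamma> h (Suc j)) \<longlonglongrightarrow> (1 - \<gamma> - \<delta>\<^sup>2 * 0) / (\<delta>\<^sup>2 * (1 - 0))"
    unfolding t_const_def by (intro tendsto_intros \<sigma>) (use d in auto)
  have s: "(\<lambda>j. s_const \<delta> \<gamma> h (Suc j)) \<longlonglongrightarrow> (\<gamma> - 0) / (1 - \<delta>\<^sup>2 - 0)"
    unfolding s_const_def by (intro tendsto_intros \<sigma>) (use d in auto)
  have "(\<lambda>j. t_const \<delta> \<gamma> h (Suc j) * \<delta>\<^sup>2 + s_const \<delta> \<gamma> h (Suc j) * (1 - \<delta>\<^sup>2) + 128 * L\<^sup>2 * inverse (real (subdiv (Suc j))))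
      \<longlonglongrightarrow> (1 - \<gamma> - \<delta>\<^sup>2 * 0) / (\<delta>\<^sup>2 * (1 - 0)) * \<delta>\<^sup>2 + (\<gamma> - 0) / (1 - \<delta>\<^sup>2 - 0) * (1 - \<delta>\<^sup>2) + 128 * L\<^sup>2 * 0"
    by (intro tendsto_intros t s n)
  also have "(1 - \<gamma> - \<delta>\<^sup>2 * 0) / (\<delta>\<^sup>2 * (1 - 0)) * \<delta>\<^sup>2 + (\<gamma> - 0) / (1 - \<delta>\<^sup>2 - 0) * (1 - \<delta>\<^sup>2) + 128 * L\<^sup>2 * 0 = 1"
    using d by simp
  finally have ev1: "\<forall>\<^sub>F j in sequentially. t_const \<delta> \<gamma> h (Suc j) * \<delta>\<^sup>2 + s_const \<delta> \<gamma> h (Suc j) * (1 - \<delta>\<^sup>2) + 128 * L\<^sup>2 * inverse (real (subdiv (Suc j))) < 8 / 7"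
    by (rule order_tendstoD(2)) simp
  have "(\<lambda>j. t_const \<delta> \<gamma> h (Suc j) * \<delta>\<^sup>2 * (1 - 4 * inverse (real (subdiv (Suc j)))))
      \<longlonglongrightarrow> (1 - \<gamma> - \<delta>\<^sup>2 * 0) / (\<delta>\<^sup>2 * (1 - 0)) * \<delta>\<^sup>2 * (1 - 4 * 0)"
    by (intro tendsto_intros t n)
  also have "(1 - \<gamma> - \<delta>\<^sup>2 * 0) / (\<delta>\<^sup>2 * (1 - 0)) * \<delta>\<^sup>2 * (1 - 4 * 0) = 1 - \<gamma>"
    using d by simp
  finally have ev2: "\<forall>\<^sub>F j in sequentially. 14 * \<delta> < t_const \<delta> \<gamma> h (Suc j) * \<delta>\<^sup>2 * (1 - 4 * inverse (real (subdiv (Suc j))))"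
    by (rule order_tendstoD(1)) (use \<gamma>_less in simp)
  show ?thesis
    using ev1 ev2 eventually_ge_at_top[of 1]
  proof eventually_elim
    case (elim j)
    show ?case
    proof (intro ballI conjI)
      fix Q assume Q: "Q \<in> squares \<delta> h j"
      note a = square_areas[OF elim(3) Q]
      have "t_const \<delta> \<gamma> h (Suc j) * \<delta>\<^sup>2 + s_const \<delta> \<gamma> h (Suc j) * (1 - \<delta>\<^sup>2) + 128 * L\<^sup>2 / real (subdiv (Suc j)) \<le> 8 / 7"
        using elim(1) unfolding divide_inverse by (rule less_imp_le)
      from order.trans[OF a(1) mult_right_mono[OF this zero_le_power2]]
      show "measure lebesgue (\<phi> ` region Q) \<le> 8 / 7 * (snd Q)\<^sup>2" .
      have "14 * \<delta> \<le> t_const \<delta> \<gamma> h (Suc j) * \<delta>\<^sup>2 * (1 - 4 / real (subdiv (Suc j)))"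
        using elim(2) unfolding divide_inverse by (rule less_imp_le)
      from order.trans[OF mult_right_mono[OF this zero_le_power2] a(2)]
      show "14 * \<delta> * (snd Q)\<^sup>2 \<le> measure lebesgue (\<phi> ` region (concentric \<delta> Q))" .
    qed
  qed
qed

section \<open>Non-realisability of the McMullen density\<close>

text \<open>
  The relative loss \<open>\<tau>\<close> allowed to a block depends only on \<open>M\<close> and is so small that its sides deviate
  from straight lines by less than \<open>c / (4 M)\<close>. Half of the loss is spent on the defect \<open>M - r\<close> of the
  nearly maximal edge, the other half on the difference between the two sides of the row, which is small
  once there are at least \<open>28 / \<tau>\<close> cells in it.
\<close>

lemma no_such_map: False
proof -
  \<comment> \<open>The two summands of the denominator give \<open>14 M c \<kappa> < (c / (4 M))\<^sup>2\<close> and \<open>2 \<kappa> < M c\<close> for \<open>\<kappa> = \<tau> M c\<close>.\<close>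
  define \<tau> where "\<tau> = 1 / (448 * M ^ 4 + 4)"
  have M4: "0 < M ^ 4"
    using M_pos by simp
  have \<tau>: "0 < \<tau>" "\<tau> < 1 / 2" "224 * M ^ 4 * \<tau> < 1"
    using M4 by (simp_all add: \<tau>_def pos_divide_less_eq add_pos_pos)
  define r where "r = M - \<tau> * M / 28"
  have r: "0 \<le> r" "r < M" "14 * (M - r) = \<tau> * M / 2"
    using M_pos \<tau> mult_left_le_one_le[of M \<tau>] by (auto simp: r_def)
  obtain J1 where J1: "\<And>j Q. J1 \<le> j \<Longrightarrow> Q \<in> squares \<delta> h j \<Longrightarrow>
    measure lebesgue (\<phi> ` region Q) \<le> 8 / 7 * (snd Q)\<^sup>2 \<and>
    14 * \<delta> * (snd Q)\<^sup>2 \<le> measure lebesgue (\<phi> ` region (concentric \<delta> Q))"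
    using eventually_square_areas unfolding eventually_sequentially by blast
  obtain J2 where J2: "\<And>j. J2 \<le> j \<Longrightarrow> 28 / \<tau> \<le> real (subdiv j)"
    using subdiv_at_top unfolding filterlim_at_top eventually_sequentially by blast
  obtain Q p d b j where Q: "max J1 J2 \<le> j" "1 \<le> j" "Q \<in> nodes j" "corner_frame Q p d b"
    "r * snd Q < norm (\<phi> (p + snd Q *\<^sub>R d) - \<phi> p)"
    using nearly_maximal_edge[OF r(2)] .
  obtain m where m: "subdiv (Suc j) = 7 * m"
    using subdiv(2)[of "Suc j"] Q(2) by (auto elim: dvdE)
  define c where "c = snd Q / real (subdiv (Suc j))"
  have n: "7 \<le> subdiv (Suc j)" "28 / \<tau> \<le> real (subdiv (Suc j))"
    using subdiv(3)[of "Suc j"] Q(1,2) J2[of "Suc j"] by auto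
  have c: "0 < c" "snd Q = real (subdiv (Suc j)) * c"
    using nodes_pos_subset(1)[OF Q(3)] n(1) by (auto simp: c_def)
  obtain u w k where uw: "orthonormal u w" and k: "k < m" and straight: "\<forall>a \<in> {p, p + c *\<^sub>R b}.
      (\<phi> (a + (real (7 * Suc k) * c) *\<^sub>R d) - \<phi> (a + (real (7 * k) * c) *\<^sub>R d)) \<bullet> u \<ge>
        M * (7 * c) - (14 * (M - r) + 2 * M / real m) * c"
    by (rule two_straight_lines[OF Q(2-5) r(1) m, folded c_def])
  obtain C where C: "\<And>i. i < subdiv (Suc j) \<Longrightarrow> C i \<in> squares \<delta> h (Suc j)" "\<And>i. i < subdiv (Suc j) \<Longrightarrow> snd (C i) = c"
    "\<And>i. i < subdiv (Suc j) \<Longrightarrow> corner_frame (C i) (p + (real i * c) *\<^sub>R d) d b"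
    using row_cells[OF Q(2-4)] unfolding c_def by metis
  define p0 where "p0 = p + (real (7 * k) * c) *\<^sub>R d"
  define D where "D = (\<lambda>i. C (7 * k + i))"
  have D: "D i \<in> squares \<delta> h (Suc j)" "D i \<in> nodes (Suc j)" "snd (D i) = c" "corner_frame (D i) (p0 + (real i * c) *\<^sub>R d) d b"
    if "i < 7" for i
  proof -
    have i: "7 * k + i < subdiv (Suc j)"
      using that k m by simp
    show "D i \<in> squares \<delta> h (Suc j)" "snd (D i) = c"
      using C(1,2)[OF i] by (simp_all add: D_def)
    then show "D i \<in> nodes (Suc j)"
      by (simp add: nodes_def)
    have "p + (real (7 * k + i) * c) *\<^sub>R d = p0 + (real i * c) *\<^sub>R d"
      by (simp add: p0_def algebra_simps)
    then show "corner_frame (D i) (p0 + (real i * c) *\<^sub>R d) d b"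
      using C(3)[OF i] by (simp add: D_def)
  qed
  have D3: "corner_frame (D 3) (p0 + (3 * c) *\<^sub>R d) d b"
    using D(4)[of 3] by simp
  have db: "orthonormal d b"
    by (rule corner_frame_orthonormal[OF Q(4)])
  define \<kappa> where "\<kappa> = \<tau> * M * c"
  have \<kappa>: "0 \<le> \<kappa>" "(14 * (M - r) + 2 * M / real m) * c \<le> \<kappa>"
  proof -
    show "0 \<le> \<kappa>"
      using \<tau> M_pos c(1) by (simp add: \<kappa>_def)
    have "4 / \<tau> \<le> real m"
      using n(2) m by simp
    then have "4 \<le> \<tau> * real m" "0 < real m"
      using \<tau>(1) k by (auto simp: pos_divide_le_eq mult.commute)
    then have "2 * M / real m \<le> \<tau> * M / 2"
      using mult_right_mono[of 4 "\<tau> * real m" M] M_pos by (simp add: pos_divide_le_eq mult.commute mult.left_commute)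
    then have "14 * (M - r) + 2 * M / real m \<le> \<tau> * M"
      using r(3) by simp
    then show "(14 * (M - r) + 2 * M / real m) * c \<le> \<kappa>"
      unfolding \<kappa>_def using c(1) by (intro mult_right_mono) auto
  qed
  let ?T = "concentric \<delta> (D 3)"
  let ?r = "p0 + (3 * c) *\<^sub>R d + ((1 - \<delta>) / 2 * c) *\<^sub>R (d + b)"
  have T: "corner_frame ?T ?r d b" "?T \<in> nodes (Suc j)" "snd ?T = \<delta> * c"
    using corner_frame_concentric[OF D3, of \<delta>] D(1)[of 3] D(3)[of 3] by (auto simp: nodes_def concentric_def)
  have sj: "1 \<le> Suc j" by simp
  have line: "norm (\<phi> (a + t *\<^sub>R d) - \<phi> (a + s *\<^sub>R d)) \<le> M * (t - s)"
    if a: "a \<in> {p0, p0 + c *\<^sub>R b}" and st: "0 \<le> s" "s \<le> t" "t \<le> 7 * c" for a s t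
  proof -
    obtain a' where a': "a' \<in> {p, p + c *\<^sub>R b}" "a = a' + (real (7 * k) * c) *\<^sub>R d"
      using a by (auto simp: p0_def)
    have "real (7 * Suc k) * c \<le> real (subdiv (Suc j)) * c"
      using k m c(1) by (intro mult_right_mono) auto
    then have "real (7 * k) * c + t \<le> snd Q"
      using st(3) c(2) by (simp add: algebra_simps)
    moreover have "0 \<le> real (7 * k) * c"
      using c(1) by simp
    ultimately have "norm (\<phi> (a' + (real (7 * k) * c + t) *\<^sub>R d) - \<phi> (a' + (real (7 * k) * c + s) *\<^sub>R d))
        \<le> M * ((real (7 * k) * c + t) - (real (7 * k) * c + s))"
      using st by (intro row_lines_lipschitz[OF Q(2-4), folded c_def] a'(1)) auto
    then show ?thesis
      by (simp add: a'(2) scaleR_left_distrib add.assoc)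
  qed
  \<comment> \<open>The block consists of the seven cells \<open>D 0, \<dots>, D 6\<close>, with \<open>D 3\<close> in the middle.\<close>
  have cells: "rect p0 d b (7 * c) c \<subseteq> (\<Union>i<7. region (D i))"
  proof
    fix z assume "z \<in> rect p0 d b (7 * c) c"
    then obtain s t where z: "z = p0 + s *\<^sub>R d + t *\<^sub>R b" "0 \<le> s" "s \<le> 7 * c" "0 \<le> t" "t \<le> c"
      using orthonormal_rect_cases[OF db] by blast
    obtain i where i: "i < 7" "real i * c \<le> s" "s \<le> real (Suc i) * c"
      using grid_index[of s 7 c] z c(1) by auto
    have "p0 + (real i * c) *\<^sub>R d + (s - real i * c) *\<^sub>R d + t *\<^sub>R b \<in> region (D i)"
      by (rule corner_frame_mem[OF D(4)[OF i(1)]]) (use i z D(3)[OF i(1)] in \<open>simp_all add: distrib_right\<close>)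
    then show "z \<in> (\<Union>i<7. region (D i))"
      using i(1) z(1) by (auto simp: scaleR_left_diff_distrib)
  qed
  have Dunit: "region (D i) \<subseteq> unit_square" if "i < 7" for i
    using nodes_pos_subset(2)[OF D(2)[OF that]] .
  have R: "rect p0 d b (7 * c) c \<subseteq> unit_square"
    using cells Dunit by blast
  have reg: "region (D 3) = rect (p0 + (3 * c) *\<^sub>R d) d b c c" "inner_region (D 3) = open_rect (p0 + (3 * c) *\<^sub>R d) d b c c"
    using corner_frame_region[OF D3] corner_frame_inner_region[OF D3] D(3)[of 3] by auto
  have regT: "region ?T = rect ?r d b (\<delta> * c) (\<delta> * c)" "inner_region ?T = open_rect ?r d b (\<delta> * c) (\<delta> * c)"
    using corner_frame_region[OF T(1)] corner_frame_inner_region[OF T(1)] T(3) by auto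
  show False
  proof (rule no_long_thin_image[OF db uw c(1) M_pos \<delta>_pos \<kappa>(1)])
    show "0 < c / (4 * M)"
      using c(1) M_pos by simp
    show "2 * \<kappa> < M * c"
      using mult_strict_right_mono[OF \<tau>(2), of "M * c"] M_pos c(1) by (simp add: \<kappa>_def)
    have "224 * M ^ 4 * \<tau> * (c\<^sup>2 / (16 * M\<^sup>2)) < 1 * (c\<^sup>2 / (16 * M\<^sup>2))"
      using \<tau>(3) M_pos c(1) by (intro mult_strict_right_mono) auto
    then show "14 * M * c * \<kappa> < (c / (4 * M))\<^sup>2"
      using M_pos by (simp add: \<kappa>_def power_divide power_mult_distrib power2_eq_square power4_eq_xxxx field_simps)
    show "8 * M * (c / (4 * M)) < 3 * c"
      using M_pos c(1) by simp
    show "continuous_on (rect p0 d b (7 * c) c) \<phi>"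
      by (rule continuous_on_subset[OF continuous R])
    show "inj_on \<phi> (rect p0 d b (7 * c) c)"
      by (rule inj_on_subset[OF injective R])
    show "norm (\<phi> (a + s *\<^sub>R d) - \<phi> a) \<le> M * s" if "a \<in> {p0, p0 + c *\<^sub>R b}" "0 \<le> s" "s \<le> 7 * c" for a s
      using line[OF that(1) order.refl that(2,3)] by simp
    show "norm (\<phi> (a + (7 * c) *\<^sub>R d) - \<phi> (a + s *\<^sub>R d)) \<le> M * (7 * c - s)"
      if "a \<in> {p0, p0 + c *\<^sub>R b}" "0 \<le> s" "s \<le> 7 * c" for a s
      using line[OF that order.refl] .
    show "M * (7 * c) - \<kappa> \<le> (\<phi> (a + (7 * c) *\<^sub>R d) - \<phi> a) \<bullet> u" if a: "a \<in> {p0, p0 + c *\<^sub>R b}" for a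
    proof -
      obtain a' where a': "a' \<in> {p, p + c *\<^sub>R b}" "a = a' + (real (7 * k) * c) *\<^sub>R d"
        using a by (auto simp: p0_def)
      have eq: "a + (7 * c) *\<^sub>R d = a' + (real (7 * Suc k) * c) *\<^sub>R d"
        by (simp add: a'(2) algebra_simps)
      have "M * (7 * c) - \<kappa> \<le> M * (7 * c) - (14 * (M - r) + 2 * M / real m) * c"
        using \<kappa>(2) by linarith
      from order.trans[OF this bspec[OF straight a'(1)]] show ?thesis
        unfolding eq unfolding a'(2) .
    qed
    show "norm (\<phi> (a + t *\<^sub>R b) - \<phi> a) \<le> M * t" if a: "a \<in> {p0, p0 + (7 * c) *\<^sub>R d}" and t: "0 \<le> t" "t \<le> c" for a t
    proof -
      have 0: "corner_frame (D 0) p0 b d"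
        using corner_frame_swap[OF D(4)[of 0]] by simp
      have eq: "p0 + (6 * c) *\<^sub>R d + c *\<^sub>R d = p0 + (7 * c) *\<^sub>R d"
        by (simp add: add.assoc scaleR_left_distrib[symmetric])
      have "corner_frame (D 6) (p0 + (6 * c) *\<^sub>R d + c *\<^sub>R d) b (- d)"
        using corner_frame_swap[OF corner_frame_flip[OF D(4)[of 6]]] D(3)[of 6] by simp
      then have 6: "corner_frame (D 6) (p0 + (7 * c) *\<^sub>R d) b (- d)"
        unfolding eq .
      show ?thesis
        using a edge_le[OF sj D(2) 0 t(1)] edge_le[OF sj D(2) 6 t(1)] D(3)[of 0] D(3)[of 6] t(2) by auto
    qed
    show "norm (\<phi> q - \<phi> a) \<le> 2 * M * c"
      if a: "a \<in> {p0 + (3 * c) *\<^sub>R d, p0 + (4 * c) *\<^sub>R d}"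
        and q: "q \<in> rect (p0 + (3 * c) *\<^sub>R d) d b c c - open_rect (p0 + (3 * c) *\<^sub>R d) d b c c" for a q
    proof -
      have eq: "p0 + (3 * c) *\<^sub>R d + c *\<^sub>R d = p0 + (4 * c) *\<^sub>R d"
        by (simp add: add.assoc scaleR_left_distrib[symmetric])
      have "corner_frame (D 3) (p0 + (3 * c) *\<^sub>R d + c *\<^sub>R d) (- d) b"
        using corner_frame_flip[OF D3] D(3)[of 3] by simp
      then have 4: "corner_frame (D 3) (p0 + (4 * c) *\<^sub>R d) (- d) b"
        unfolding eq .
      have q': "q \<in> region (D 3) - inner_region (D 3)"
        using q reg by simp
      show ?thesis
        using a square_edge_distance[OF sj D(2) D3 q'] square_edge_distance[OF sj D(2) 4 q'] D(3)[of 3] by auto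
    qed
    show "rect ?r d b (\<delta> * c) (\<delta> * c) \<subseteq> rect (p0 + (3 * c) *\<^sub>R d) d b c c"
      using concentric_in_square(3)[of "D 3"] D(3)[of 3] c(1) reg(1) regT(1) by simp
    show "norm (\<phi> q - \<phi> ?r) \<le> 2 * M * (\<delta> * c)"
      if "q \<in> rect ?r d b (\<delta> * c) (\<delta> * c) - open_rect ?r d b (\<delta> * c) (\<delta> * c)" for q
      using square_edge_distance[OF sj T(2,1), of q] that regT T(3) by simp
    have comp: "compact (\<phi> ` region (D i))" if "i < 7" for i
      by (rule compact_image[OF compact_region Dunit[OF that]])
    have "\<phi> ` rect p0 d b (7 * c) c \<subseteq> (\<Union>i<7. \<phi> ` region (D i))"
      using cells by blast
    then have "measure lebesgue (\<phi> ` rect p0 d b (7 * c) c) \<le> measure lebesgue (\<Union>i<7. \<phi> ` region (D i))"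
      using compact_image[OF compact_rect[OF db] R] comp
      by (intro measure_mono_fmeasurable fmeasurableD lmeasurable_compact compact_UN) auto
    also have "\<dots> \<le> (\<Sum>i<7. measure lebesgue (\<phi> ` region (D i)))"
      using comp by (intro measure_UNION_le fmeasurableD lmeasurable_compact) auto
    also have "\<dots> \<le> (\<Sum>i<(7::nat). 8 / 7 * c\<^sup>2)"
    proof (rule sum_mono)
      fix i :: nat assume "i \<in> {..<7}"
      then have i: "i < 7" by simp
      show "measure lebesgue (\<phi> ` region (D i)) \<le> 8 / 7 * c\<^sup>2"
        using J1[of "Suc j" "D i"] Q(1) D(1,3)[OF i] by simp
    qed
    finally show "measure lebesgue (\<phi> ` rect p0 d b (7 * c) c) \<le> 8 * c\<^sup>2"
      by simp
    show "14 * \<delta> * c\<^sup>2 \<le> measure lebesgue (\<phi> ` rect ?r d b (\<delta> * c) (\<delta> * c))"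
      using J1[of "Suc j" "D 3"] Q(1) D(1)[of 3] D(3)[of 3] regT(1) by simp
  qed
qed

end

theorem theorem1:
  fixes \<delta> \<gamma> t1 s1 :: real and h :: "nat \<Rightarrow> real"
  assumes "0 < \<delta>" and "\<delta> < 1 / 14"
    and "0 < \<gamma>" and "\<gamma> < 1 - 14 * \<delta>"
    and "admissible \<gamma> h"
    and "initial_constants \<delta> \<gamma> t1 s1"
  shows "\<not> (\<exists>(A :: (real^2) set) (\<phi> :: real^2 \<Rightarrow> real^2).
            bilipschitz \<phi> unit_square A \<and>
            (AE x in lebesgue_on unit_square.
               has_Jac \<phi> unit_square x (mcmullen_density \<delta> \<gamma> h t1 s1 x)))"
proof
  assume "\<exists>(A :: (real^2) set) (\<phi> :: real^2 \<Rightarrow> real^2).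
            bilipschitz \<phi> unit_square A \<and>
            (AE x in lebesgue_on unit_square.
               has_Jac \<phi> unit_square x (mcmullen_density \<delta> \<gamma> h t1 s1 x))"
  then obtain A \<phi> where \<phi>: "bilipschitz \<phi> unit_square A"
    "AE x in lebesgue_on unit_square. has_Jac \<phi> unit_square x (mcmullen_density \<delta> \<gamma> h t1 s1 x)"
    by blast
  then obtain L where L: "0 < L" "L-lipschitz_on unit_square \<phi>"
    by (auto simp: bilipschitz_def)
  interpret mcmullen_jacobian \<delta> \<gamma> h \<phi> L t1 s1
    by unfold_locales (use assms \<phi> L in \<open>auto simp: bilipschitz_def bij_betw_def\<close>)
  show False
    by (rule no_such_map)
qed

end
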